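(* Let $L$ be a regular forest language over a finite alphabet $A$, with syntactic forest algebra $(H_L,V_L)$. Then $L$ is piecewise testable if and only if $$u^\omega v = u^\omega = v u^\omega$$ holds for all $u,v\in V_L$ such that $v\preceq u$.
   Context: Forests over a finite alphabet $A$ are finite, ordered, unranked, $A$-labelled forests (finite sequences of trees, with the empty forest $0$ allowed). A context is a forest over $A\cup\{\Box\}$ in which exactly one node has label $\Box$ (the hole) and that node is a leaf; $\Box$ alone is the empty context. For contexts $p,q$ and a forest $s$: $ps$ (resp. $pq$) replaces the hole of $p$ by $s$ (resp. $q$); $s+t$ is concatenation of forests. A forest language over $A$ is a set of forests over $A$. Forest algebra: a pair $(H,V)$ of monoids, $H$ written additively (not necessarily commutative) with identity $0$, $V$ multiplicatively with identity $\Box$, with a faithful monoidal left action of $V$ on $H$, such that for each $g\in H$ there are elements $g+\Box,\ \Box+g\in V$ with $(g+\Box)h=g+h$ and $(\Box+g)h=h+g$ for all $h\in H$. A morphism of forest algebras is a pair of monoid morphisms compatible with the actions. The free forest algebra $A^\Delta$ consists of all forests and all contexts over $A$. Syntactic algebra: for a forest language $L$, put $s\sim_L s'$ if for every context $p$, $ps\in L\iff ps'\in L$; for contexts put $p\sim_L p'$ if $ps\sim_L p's$ for all forests $s$. The quotient $(H_L,V_L)$ of $A^\Delta$ by $\sim_L$ is the syntactic forest algebra of $L$; $L$ is regular iff $(H_L,V_L)$ is finite. Pieces: a forest $s$ is a piece of a forest $t$ ($s\preceq t$) if $s$ is obtained from $t$ by deleting some nodes (children of a deleted node are attached, in order, in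 its place); equivalently there is an injective label-preserving map from nodes of $s$ to nodes of $t$ preserving (in both directions) the ancestor relation and the depth-first left-first order. For contexts $p\preceq q$ means $p$ is obtained from $q$ by deleting non-hole nodes. In a forest algebra $(H,V)$, for $v,w\in V$, $v\preceq w$ means that there are a finite alphabet $B$, a morphism $\alpha:B^\Delta\to(H,V)$, and contexts $p\preceq q$ over $B$ with $\alpha(p)=v$ and $\alpha(q)=w$. $L$ is piecewise testable if there is $n\ge 0$ such that membership of $t$ in $L$ depends only on the set of pieces of $t$ with at most $n$ nodes. $\omega>0$ denotes an integer such that $v^\omega$ is idempotent for every $v$ in the finite monoid $V_L$ (the value $v^\omega$ does not depend on the choice).
   Formalization: In the definition of v ≼ u, morphisms of forest algebras are also required to preserve g+□ and □+g; with mere compatibility with the actions the claim fails, e.g. for L = "has the piece a(b)", where v = [a(□)] ≠ 1 would satisfy v ≼ 1. *)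

theory Defs
  imports "HOL-Algebra.Group"
begin

datatype 'a tree = Node 'a "'a tree list"

type_synonym 'a forest = "'a tree list"

fun labels :: "'a forest \<Rightarrow> 'a list" where
  "labels [] = []"
| "labels (Node a us # ts) = a # labels us @ labels ts"

abbreviation num_nodes :: "'a forest \<Rightarrow> nat" where
  "num_nodes t \<equiv> length (labels t)"

definition forests :: "'a set \<Rightarrow> 'a forest set" where
  "forests A = {t. set (labels t) \<subseteq> A}"

text \<open>Contexts over \<open>A\<close> are forests over \<open>A\<close> with one extra label: \<^term>\<open>Some a\<close> stands for the
  letter \<open>a\<close> and \<^term>\<open>None\<close> for the hole.\<close>

type_synonym 'a ctxt = "'a option forest"

fun holes_are_leaves :: "'a ctxt \<Rightarrow> bool" where
  "holes_are_leaves [] \<longleftrightarrow> True"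
| "holes_are_leaves (Node x us # ts) \<longleftrightarrow>
     (x = None \<longrightarrow> us = []) \<and> holes_are_leaves us \<and> holes_are_leaves ts"

definition contexts :: "'a set \<Rightarrow> 'a ctxt set" where
  "contexts A = {p \<in> forests (insert None (Some ` A)).
     count_list (labels p) None = 1 \<and> holes_are_leaves p}"

definition hole :: "'a ctxt" where
  "hole = [Node None []]"

definition embed :: "'a forest \<Rightarrow> 'a ctxt" where
  "embed = map (map_tree Some)"

fun plug :: "'a ctxt \<Rightarrow> 'a forest \<Rightarrow> 'a forest" where
  "plug [] s = []"
| "plug (Node None us # ts) s = s @ plug ts s"
| "plug (Node (Some a) us # ts) s = Node a (plug us s) # plug ts s"

fun comp_ctxt :: "'a ctxt \<Rightarrow> 'a ctxt \<Rightarrow> 'a ctxt" where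
  "comp_ctxt [] q = []"
| "comp_ctxt (Node None us # ts) q = q @ comp_ctxt ts q"
| "comp_ctxt (Node (Some a) us # ts) q = Node (Some a) (comp_ctxt us q) # comp_ctxt ts q"

inductive delete_node :: "'a forest \<Rightarrow> 'a forest \<Rightarrow> bool" where
  here: "delete_node (xs @ Node a us # ys) (xs @ us @ ys)"
| below: "delete_node us vs \<Longrightarrow> delete_node (xs @ Node a us # ys) (xs @ Node a vs # ys)"

text \<open>On contexts this is deletion of non-hole nodes: if both sides have exactly one hole,
  no deletion step can have removed it.\<close>

definition piece :: "'a forest \<Rightarrow> 'a forest \<Rightarrow> bool" (infix \<open>\<preceq>\<^sub>p\<close> 50) where
  "s \<preceq>\<^sub>p t \<longleftrightarrow> delete_node\<^sup>*\<^sup>* t s"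

definition piecewise_testable :: "'a set \<Rightarrow> 'a forest set \<Rightarrow> bool" where
  "piecewise_testable A L \<longleftrightarrow>
     (\<exists>n. \<forall>s \<in> forests A. \<forall>t \<in> forests A.
        {r. r \<preceq>\<^sub>p s \<and> num_nodes r \<le> n} = {r. r \<preceq>\<^sub>p t \<and> num_nodes r \<le> n} \<longrightarrow>
        (s \<in> L \<longleftrightarrow> t \<in> L))"

text \<open>The additive monoid \<open>H\<close> is a \<^typ>\<open>'h monoid\<close> like any other, so its addition is
  written \<open>\<otimes>\<close> and its zero \<open>\<one>\<close>. The elements \<open>g + \<box>\<close> and \<open>\<box> + g\<close> of \<open>V\<close>, which are
  unique by faithfulness, are part of the structure.\<close>

record ('h, 'v) forest_alg =
  Hor :: "'h monoid"
  Ver :: "'v monoid"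
  act :: "'v \<Rightarrow> 'h \<Rightarrow> 'h"
  add_left :: "'h \<Rightarrow> 'v"
  add_right :: "'h \<Rightarrow> 'v"

locale forest_algebra =
  fixes F :: "('h, 'v) forest_alg"
  assumes Hor_monoid: "monoid (Hor F)"
    and Ver_monoid: "monoid (Ver F)"
    and act_closed: "\<And>v h. \<lbrakk>v \<in> carrier (Ver F); h \<in> carrier (Hor F)\<rbrakk> \<Longrightarrow> act F v h \<in> carrier (Hor F)"
    and act_one: "\<And>h. h \<in> carrier (Hor F) \<Longrightarrow> act F \<one>\<^bsub>Ver F\<^esub> h = h"
    and act_mult: "\<And>v w h. \<lbrakk>v \<in> carrier (Ver F); w \<in> carrier (Ver F); h \<in> carrier (Hor F)\<rbrakk>
      \<Longrightarrow> act F (v \<otimes>\<^bsub>Ver F\<^esub> w) h = act F v (act F w h)"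
    and act_faithful: "\<And>v w. \<lbrakk>v \<in> carrier (Ver F); w \<in> carrier (Ver F);
      \<And>h. h \<in> carrier (Hor F) \<Longrightarrow> act F v h = act F w h\<rbrakk> \<Longrightarrow> v = w"
    and add_left_closed: "\<And>g. g \<in> carrier (Hor F) \<Longrightarrow> add_left F g \<in> carrier (Ver F)"
    and add_left_act: "\<And>g h. \<lbrakk>g \<in> carrier (Hor F); h \<in> carrier (Hor F)\<rbrakk>
      \<Longrightarrow> act F (add_left F g) h = g \<otimes>\<^bsub>Hor F\<^esub> h"
    and add_right_closed: "\<And>g. g \<in> carrier (Hor F) \<Longrightarrow> add_right F g \<in> carrier (Ver F)"
    and add_right_act: "\<And>g h. \<lbrakk>g \<in> carrier (Hor F); h \<in> carrier (Hor F)\<rbrakk>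
      \<Longrightarrow> act F (add_right F g) h = h \<otimes>\<^bsub>Hor F\<^esub> g"

text \<open>Preservation of \<open>g + \<box>\<close> and \<open>\<box> + g\<close> has to be required: it follows from the other
  conditions if \<open>\<alpha>\<close> is onto the horizontal monoid of the target, but not in general.\<close>

definition forest_alg_morphism ::
  "('g, 'u) forest_alg \<Rightarrow> ('h, 'v) forest_alg \<Rightarrow> ('g \<Rightarrow> 'h) \<Rightarrow> ('u \<Rightarrow> 'v) \<Rightarrow> bool" where
  "forest_alg_morphism F G \<alpha> \<beta> \<longleftrightarrow>
     \<alpha> \<in> hom (Hor F) (Hor G) \<and> \<alpha> \<one>\<^bsub>Hor F\<^esub> = \<one>\<^bsub>Hor G\<^esub> \<and>
     \<beta> \<in> hom (Ver F) (Ver G) \<and> \<beta> \<one>\<^bsub>Ver F\<^esub> = \<one>\<^bsub>Ver G\<^esub> \<and>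
     (\<forall>v \<in> carrier (Ver F). \<forall>h \<in> carrier (Hor F). \<alpha> (act F v h) = act G (\<beta> v) (\<alpha> h)) \<and>
     (\<forall>h \<in> carrier (Hor F). \<beta> (add_left F h) = add_left G (\<alpha> h)) \<and>
     (\<forall>h \<in> carrier (Hor F). \<beta> (add_right F h) = add_right G (\<alpha> h))"

definition free_forest_alg :: "'a set \<Rightarrow> ('a forest, 'a ctxt) forest_alg" where
  "free_forest_alg A = \<lparr>
     Hor = \<lparr>carrier = forests A, monoid.mult = (@), one = []\<rparr>,
     Ver = \<lparr>carrier = contexts A, monoid.mult = comp_ctxt, one = hole\<rparr>,
     act = plug,
     add_left = (\<lambda>s. embed s @ hole),
     add_right = (\<lambda>s. hole @ embed s)\<rparr>"

text \<open>Finite subsets of \<^typ>\<open>nat\<close> are all finite alphabets up to renaming of letters.\<close>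

definition ver_piece :: "('h, 'v) forest_alg \<Rightarrow> 'v \<Rightarrow> 'v \<Rightarrow> bool" where
  "ver_piece F v w \<longleftrightarrow>
     (\<exists>(B :: nat set) \<alpha> \<beta>. finite B \<and> forest_alg_morphism (free_forest_alg B) F \<alpha> \<beta> \<and>
        (\<exists>p \<in> contexts B. \<exists>q \<in> contexts B. p \<preceq>\<^sub>p q \<and> \<beta> p = v \<and> \<beta> q = w))"

definition syn_rel :: "'a set \<Rightarrow> 'a forest set \<Rightarrow> 'a forest rel" where
  "syn_rel A L = {(s, s'). s \<in> forests A \<and> s' \<in> forests A \<and>
     (\<forall>p \<in> contexts A. plug p s \<in> L \<longleftrightarrow> plug p s' \<in> L)}"

definition syn_rel_ctxt :: "'a set \<Rightarrow> 'a forest set \<Rightarrow> 'a ctxt rel" where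
  "syn_rel_ctxt A L = {(p, p'). p \<in> contexts A \<and> p' \<in> contexts A \<and>
     (\<forall>s \<in> forests A. (plug p s, plug p' s) \<in> syn_rel A L)}"

definition syntactic_alg :: "'a set \<Rightarrow> 'a forest set \<Rightarrow> ('a forest set, 'a ctxt set) forest_alg" where
  "syntactic_alg A L = \<lparr>
     Hor = \<lparr>carrier = forests A // syn_rel A L,
            monoid.mult = (\<lambda>X Y. \<Union>s\<in>X. \<Union>t\<in>Y. syn_rel A L `` {s @ t}),
            one = syn_rel A L `` {[]}\<rparr>,
     Ver = \<lparr>carrier = contexts A // syn_rel_ctxt A L,
            monoid.mult = (\<lambda>P Q. \<Union>p\<in>P. \<Union>q\<in>Q. syn_rel_ctxt A L `` {comp_ctxt p q}),
            one = syn_rel_ctxt A L `` {hole}\<rparr>,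
     act = (\<lambda>P X. \<Union>p\<in>P. \<Union>s\<in>X. syn_rel A L `` {plug p s}),
     add_left = (\<lambda>X. \<Union>s\<in>X. syn_rel_ctxt A L `` {embed s @ hole}),
     add_right = (\<lambda>X. \<Union>s\<in>X. syn_rel_ctxt A L `` {hole @ embed s})\<rparr>"

definition regular :: "'a set \<Rightarrow> 'a forest set \<Rightarrow> bool" where
  "regular A L \<longleftrightarrow>
     finite (carrier (Hor (syntactic_alg A L))) \<and> finite (carrier (Ver (syntactic_alg A L)))"



lemma labels_append [simp]: "labels (s @ t) = labels s @ labels t"
  by (induction s rule: labels.induct) auto

lemma labels_embed [simp]: "labels (embed s) = map Some (labels s)"
  by (induction s rule: labels.induct) (auto simp: embed_def)

lemma holes_are_leaves_append [simp]:
  "holes_are_leaves (p @ q) \<longleftrightarrow> holes_are_leaves p \<and> holes_are_leaves q"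
  by (induction p rule: holes_are_leaves.induct) auto

lemma holes_are_leaves_embed [simp]: "holes_are_leaves (embed s)"
  by (induction s rule: labels.induct) (auto simp: embed_def)

lemma plug_append [simp]: "plug (p @ q) s = plug p s @ plug q s"
  by (induction p s rule: plug.induct) auto

lemma plug_embed [simp]: "plug (embed t) s = t"
  by (induction t rule: labels.induct) (auto simp: embed_def)

lemma plug_hole [simp]: "plug hole s = s"
  by (simp add: hole_def)

lemma comp_ctxt_append: "comp_ctxt (p @ q) r = comp_ctxt p r @ comp_ctxt q r"
  by (induction p r rule: comp_ctxt.induct) auto

lemma plug_comp_ctxt: "plug (comp_ctxt p q) s = plug p (plug q s)"
  by (induction p q rule: comp_ctxt.induct) auto

lemma comp_ctxt_assoc: "comp_ctxt (comp_ctxt p q) r = comp_ctxt p (comp_ctxt q r)"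
  by (induction p q rule: comp_ctxt.induct) (auto simp: comp_ctxt_append)

lemma comp_ctxt_hole_right: "holes_are_leaves p \<Longrightarrow> comp_ctxt p hole = p"
  by (induction p "hole :: 'a ctxt" rule: comp_ctxt.induct) (auto simp: hole_def)

lemma count_list_map_Some [simp]: "count_list (map Some xs) None = 0"
  by (induction xs) auto

lemma holes_are_leaves_comp_ctxt:
  "holes_are_leaves p \<Longrightarrow> holes_are_leaves q \<Longrightarrow> holes_are_leaves (comp_ctxt p q)"
  by (induction p q rule: comp_ctxt.induct) auto

lemma count_holes_comp_ctxt:
  "holes_are_leaves p \<Longrightarrow> count_list (labels (comp_ctxt p q)) None =
     count_list (labels p) None * count_list (labels q) None"
  by (induction p q rule: comp_ctxt.induct) (auto simp: algebra_simps)

lemma set_labels_comp_ctxt: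
  "set (labels (comp_ctxt p q)) \<subseteq> set (labels p) \<union> set (labels q)"
  by (induction p q rule: comp_ctxt.induct) auto

lemma set_labels_plug: "set (labels (plug p s)) \<subseteq> {a. Some a \<in> set (labels p)} \<union> set (labels s)"
  by (induction p s rule: plug.induct) auto

lemma num_nodes_plug:
  "holes_are_leaves p \<Longrightarrow> num_nodes (plug p s) + count_list (labels p) None =
     num_nodes p + count_list (labels p) None * num_nodes s"
  by (induction p s rule: plug.induct) (auto simp: algebra_simps)

lemma append_in_forests [simp]: "s \<in> forests A \<Longrightarrow> t \<in> forests A \<Longrightarrow> s @ t \<in> forests A"
  by (auto simp: forests_def)

lemma Nil_in_forests [simp]: "[] \<in> forests A"
  by (auto simp: forests_def)

lemma hole_in_contexts [simp]: "hole \<in> contexts A"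
  by (auto simp: contexts_def forests_def hole_def)

lemma embed_hole_in_contexts [simp]:
  "s \<in> forests A \<Longrightarrow> embed s @ hole \<in> contexts A"
  "s \<in> forests A \<Longrightarrow> hole @ embed s \<in> contexts A"
  by (auto simp: contexts_def forests_def hole_def)

lemma plug_in_forests [simp]: "p \<in> contexts A \<Longrightarrow> s \<in> forests A \<Longrightarrow> plug p s \<in> forests A"
  using set_labels_plug[of p s] by (simp add: contexts_def forests_def) blast

lemma comp_ctxt_in_contexts [simp]:
  "p \<in> contexts A \<Longrightarrow> q \<in> contexts A \<Longrightarrow> comp_ctxt p q \<in> contexts A"
  using set_labels_comp_ctxt[of p q]
  by (simp add: contexts_def forests_def count_holes_comp_ctxt holes_are_leaves_comp_ctxt) blast

lemma comp_ctxt_hole [simp]: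
  "comp_ctxt hole p = p"
  "p \<in> contexts A \<Longrightarrow> comp_ctxt p hole = p"
  by (simp add: hole_def) (simp add: contexts_def comp_ctxt_hole_right)

lemma plug_eq_Nil: "plug p [c] = [] \<Longrightarrow> p = []"
  by (induction p "[c]" rule: plug.induct) auto

lemma plug_eq_imp_eq:
  assumes "plug p [c] = plug q [c]" "holes_are_leaves p" "holes_are_leaves q"
    "num_nodes p < num_nodes [c]" "num_nodes q < num_nodes [c]"
  shows "p = q"
  using assms
proof (induction p arbitrary: q rule: labels.induct)
  case 1
  then show ?case using plug_eq_Nil[of q c] by simp
next
  case (2 x us ts)
  have no: "c \<noteq> Node a (plug vs [c])" if "holes_are_leaves vs" "num_nodes vs + 1 < num_nodes [c]"
    for a vs
  proof
    assume c: "c = Node a (plug vs [c])"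
    have n: "num_nodes [c] = Suc (num_nodes (plug vs [c]))"
      using arg_cong[OF c, of "\<lambda>d. num_nodes [d]"] by simp
    show False
    proof (cases "count_list (labels vs) None")
      case 0
      then show ?thesis using num_nodes_plug[OF that(1), of "[c]"] n that(2) by simp
    next
      case (Suc k)
      have "count_list (labels vs) None \<le> num_nodes vs" by (rule count_le_length)
      then show ?thesis using num_nodes_plug[OF that(1), of "[c]"] n Suc by simp
    qed
  qed
  obtain y vs ts' where q: "q = Node y vs # ts'"
  proof (cases q rule: labels.cases)
    case 1
    then show ?thesis using 2(3) plug_eq_Nil[of "Node x us # ts" c] by simp
  qed (use that in blast)
  have us: "holes_are_leaves us" "num_nodes us + 1 < num_nodes [c]"
    and ts: "holes_are_leaves ts" "num_nodes ts < num_nodes [c]"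
    and vs: "holes_are_leaves vs" "num_nodes vs + 1 < num_nodes [c]"
    and ts': "holes_are_leaves ts'" "num_nodes ts' < num_nodes [c]"
    using 2 unfolding q by simp_all
  have leaf: "x = None \<Longrightarrow> us = []" "y = None \<Longrightarrow> vs = []"
    using 2 unfolding q by simp_all
  have eq: "plug (Node x us # ts) [c] = plug (Node y vs # ts') [c]"
    using 2(3) unfolding q .
  have "x = y \<and> us = vs \<and> plug ts [c] = plug ts' [c]"
  proof (cases x; cases y)
    assume xy: "x = None" "y = None"
    then show ?thesis using eq leaf by simp
  next
    fix b assume xy: "x = None" "y = Some b"
    have "c = Node b (plug vs [c])"
      using eq unfolding xy plug.simps append_Cons list.inject by (rule conjunct1)
    then show ?thesis using no[OF vs] by (rule notE[rotated])
  next
    fix a assume xy: "x = Some a" "y = None"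
    have "Node a (plug us [c]) = c"
      using eq unfolding xy plug.simps append_Cons list.inject by (rule conjunct1)
    then show ?thesis using no[OF us] by (metis (no_types))
  next
    fix a b assume xy: "x = Some a" "y = Some b"
    then show ?thesis using eq 2(1)[of vs] us vs by simp
  qed
  then show ?case
    using 2(2)[of ts'] ts ts' unfolding q by blast
qed

lemma ex_large_tree: "a \<in> A \<Longrightarrow> \<exists>c. [c] \<in> forests A \<and> n < num_nodes [c]"
proof (induction n)
  case 0
  then show ?case by (intro exI[of _ "Node a []"]) (auto simp: forests_def)
next
  case (Suc n)
  then obtain c where "[c] \<in> forests A" "n < num_nodes [c]" by blast
  then show ?case using Suc.prems by (intro exI[of _ "Node a [c]"]) (auto simp: forests_def)
qed

lemma contexts_empty: "contexts {} = {hole}"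
proof -
  have "p = hole" if "p \<in> contexts {}" for p :: "'a ctxt"
  proof (cases p rule: labels.cases)
    case (2 x us ts)
    then have "us = []" "x = None" "set (labels ts) \<subseteq> {None}" "count_list (labels ts) None = 0"
      using that by (auto simp: contexts_def forests_def)
    moreover have "ts = []" using calculation(3,4) by (cases ts rule: labels.cases) auto
    ultimately show ?thesis using 2 by (simp add: hole_def)
  qed (use that in \<open>auto simp: contexts_def\<close>)
  then show ?thesis using hole_in_contexts by blast
qed

lemma contexts_faithful:
  assumes p: "p \<in> contexts A" and q: "q \<in> contexts A"
    and eq: "\<And>s. s \<in> forests A \<Longrightarrow> plug p s = plug q s"
  shows "p = q"
proof (cases "A = {}")
  case True
  then show ?thesis using p q by (simp add: contexts_empty)
next
  case False
  then obtain c where "[c] \<in> forests A" "num_nodes p + num_nodes q < num_nodes [c]"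
    using ex_large_tree by (metis ex_in_conv)
  then show ?thesis
    using p q eq[of "[c]"] by (intro plug_eq_imp_eq[of p c q]) (auto simp: contexts_def)
qed

lemma forest_algebra_free: "forest_algebra (free_forest_alg A)"
proof (rule forest_algebra.intro)
  show "monoid (Hor (free_forest_alg A))"
    by (intro monoidI) (auto simp: free_forest_alg_def)
  show "monoid (Ver (free_forest_alg A))"
    by (intro monoidI) (auto simp: free_forest_alg_def comp_ctxt_assoc)
qed (auto simp: free_forest_alg_def plug_comp_ctxt intro: contexts_faithful)

lemma equiv_syn_rel: "equiv (forests A) (syn_rel A L)"
  by (auto simp: equiv_def refl_on_def sym_def trans_def syn_rel_def)

lemma equiv_syn_rel_ctxt: "equiv (contexts A) (syn_rel_ctxt A L)"
  by (auto simp: equiv_def refl_on_def sym_def trans_def syn_rel_ctxt_def syn_rel_def)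


lemma syn_rel_closed: "(s, t) \<in> syn_rel A L \<Longrightarrow> s \<in> forests A \<and> t \<in> forests A"
  by (simp add: syn_rel_def)

lemma syn_rel_ctxt_closed: "(p, q) \<in> syn_rel_ctxt A L \<Longrightarrow> p \<in> contexts A \<and> q \<in> contexts A"
  by (simp add: syn_rel_ctxt_def)

lemma syn_rel_trans: "(s, t) \<in> syn_rel A L \<Longrightarrow> (t, r) \<in> syn_rel A L \<Longrightarrow> (s, r) \<in> syn_rel A L"
  by (simp add: syn_rel_def)

lemma plug_syn_rel:
  assumes "(p, q) \<in> syn_rel_ctxt A L" "(s, t) \<in> syn_rel A L"
  shows "(plug p s, plug q t) \<in> syn_rel A L"
proof (rule syn_rel_trans)
  show "(plug p s, plug p t) \<in> syn_rel A L"
    using assms by (simp add: syn_rel_def syn_rel_ctxt_def flip: plug_comp_ctxt)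
  show "(plug p t, plug q t) \<in> syn_rel A L"
    using assms by (simp add: syn_rel_def syn_rel_ctxt_def)
qed

lemma refl_syn_rel_ctxt: "p \<in> contexts A \<Longrightarrow> (p, p) \<in> syn_rel_ctxt A L"
  by (simp add: syn_rel_ctxt_def syn_rel_def)

lemma append_syn_rel:
  assumes "(s, s') \<in> syn_rel A L" "(t, t') \<in> syn_rel A L"
  shows "(s @ t, s' @ t') \<in> syn_rel A L"
proof (rule syn_rel_trans)
  show "(s @ t, s @ t') \<in> syn_rel A L"
    using plug_syn_rel[OF refl_syn_rel_ctxt[of "embed s @ hole"] assms(2)] assms
    by (simp add: syn_rel_closed)
  show "(s @ t', s' @ t') \<in> syn_rel A L"
    using plug_syn_rel[OF refl_syn_rel_ctxt[of "hole @ embed t'"] assms(1)] assms(2)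
    by (simp add: syn_rel_closed)
qed

lemma comp_ctxt_syn_rel:
  assumes "(p, p') \<in> syn_rel_ctxt A L" "(q, q') \<in> syn_rel_ctxt A L"
  shows "(comp_ctxt p q, comp_ctxt p' q') \<in> syn_rel_ctxt A L"
proof -
  have "(plug q s, plug q' s) \<in> syn_rel A L" if "s \<in> forests A" for s
    using assms(2) that by (simp add: syn_rel_ctxt_def)
  then show ?thesis
    using plug_syn_rel[OF assms(1)] syn_rel_ctxt_closed[OF assms(1)] syn_rel_ctxt_closed[OF assms(2)]
    by (subst syn_rel_ctxt_def) (simp add: plug_comp_ctxt)
qed

lemma embed_syn_rel:
  assumes "(s, t) \<in> syn_rel A L"
  shows "(embed s @ hole, embed t @ hole) \<in> syn_rel_ctxt A L"
    "(hole @ embed s, hole @ embed t) \<in> syn_rel_ctxt A L"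
proof -
  have "(r, r) \<in> syn_rel A L" if "r \<in> forests A" for r
    using that by (simp add: syn_rel_def)
  then show "(embed s @ hole, embed t @ hole) \<in> syn_rel_ctxt A L"
    "(hole @ embed s, hole @ embed t) \<in> syn_rel_ctxt A L"
    using assms syn_rel_closed[OF assms] by (auto simp: syn_rel_ctxt_def intro!: append_syn_rel)
qed

lemma syntactic_alg_carrier:
  "carrier (Hor (syntactic_alg A L)) = (\<lambda>s. syn_rel A L `` {s}) ` forests A"
  "carrier (Ver (syntactic_alg A L)) = (\<lambda>p. syn_rel_ctxt A L `` {p}) ` contexts A"
  by (auto simp: syntactic_alg_def quotient_def)

lemma syntactic_alg_closed:
  "s \<in> forests A \<Longrightarrow> syn_rel A L `` {s} \<in> carrier (Hor (syntactic_alg A L))"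
  "p \<in> contexts A \<Longrightarrow> syn_rel_ctxt A L `` {p} \<in> carrier (Ver (syntactic_alg A L))"
  by (auto simp: syntactic_alg_carrier)

lemma syntactic_algE:
  "h \<in> carrier (Hor (syntactic_alg A L)) \<Longrightarrow>
     (\<And>s. \<lbrakk>h = syn_rel A L `` {s}; s \<in> forests A\<rbrakk> \<Longrightarrow> thesis) \<Longrightarrow> thesis"
  "v \<in> carrier (Ver (syntactic_alg A L)) \<Longrightarrow>
     (\<And>p. \<lbrakk>v = syn_rel_ctxt A L `` {p}; p \<in> contexts A\<rbrakk> \<Longrightarrow> thesis) \<Longrightarrow> thesis"
  by (auto simp: syntactic_alg_carrier)

lemma syntactic_alg_simps:
  fixes A :: "'a set" and L :: "'a forest set"
  defines "F \<equiv> syntactic_alg A L" and "R \<equiv> \<lambda>s. syn_rel A L `` {s}"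
    and "C \<equiv> \<lambda>p. syn_rel_ctxt A L `` {p}"
  shows "\<lbrakk>s \<in> forests A; t \<in> forests A\<rbrakk> \<Longrightarrow> R s \<otimes>\<^bsub>Hor F\<^esub> R t = R (s @ t)"
    and "\<one>\<^bsub>Hor F\<^esub> = R []"
    and "\<lbrakk>p \<in> contexts A; q \<in> contexts A\<rbrakk> \<Longrightarrow> C p \<otimes>\<^bsub>Ver F\<^esub> C q = C (comp_ctxt p q)"
    and "\<one>\<^bsub>Ver F\<^esub> = C hole"
    and "\<lbrakk>p \<in> contexts A; s \<in> forests A\<rbrakk> \<Longrightarrow> act F (C p) (R s) = R (plug p s)"
    and "s \<in> forests A \<Longrightarrow> add_left F (R s) = C (embed s @ hole)"
    and "s \<in> forests A \<Longrightarrow> add_right F (R s) = C (hole @ embed s)"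
proof -
  note eR = equiv_syn_rel[of A L] and eC = equiv_syn_rel_ctxt[of A L]
  show "\<one>\<^bsub>Hor F\<^esub> = R []" "\<one>\<^bsub>Ver F\<^esub> = C hole"
    by (simp_all add: F_def R_def C_def syntactic_alg_def)
  have "congruent2 (syn_rel A L) (syn_rel A L) (\<lambda>s t. R (s @ t))"
    unfolding R_def by (auto intro!: congruent2I' equiv_class_eq[OF eR] append_syn_rel)
  then show "R s \<otimes>\<^bsub>Hor F\<^esub> R t = R (s @ t)" if "s \<in> forests A" "t \<in> forests A"
    using UN_equiv_class2[OF eR eR _ that] by (simp add: R_def F_def syntactic_alg_def)
  have "congruent2 (syn_rel_ctxt A L) (syn_rel_ctxt A L) (\<lambda>p q. C (comp_ctxt p q))"
    unfolding C_def by (auto intro!: congruent2I' equiv_class_eq[OF eC] comp_ctxt_syn_rel)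
  then show "C p \<otimes>\<^bsub>Ver F\<^esub> C q = C (comp_ctxt p q)" if "p \<in> contexts A" "q \<in> contexts A"
    using UN_equiv_class2[OF eC eC _ that] by (simp add: C_def F_def syntactic_alg_def)
  have "congruent2 (syn_rel_ctxt A L) (syn_rel A L) (\<lambda>p s. R (plug p s))"
    unfolding R_def by (auto intro!: congruent2I' equiv_class_eq[OF eR] plug_syn_rel)
  then show "act F (C p) (R s) = R (plug p s)" if "p \<in> contexts A" "s \<in> forests A"
    using UN_equiv_class2[OF eC eR _ that] by (simp add: C_def R_def F_def syntactic_alg_def)
  have "congruent (syn_rel A L) (\<lambda>s. C (embed s @ hole))"
    unfolding C_def by (auto intro!: congruentI equiv_class_eq[OF eC] embed_syn_rel)
  then show "add_left F (R s) = C (embed s @ hole)" if "s \<in> forests A"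
    using UN_equiv_class[OF eR _ that] by (simp add: C_def R_def F_def syntactic_alg_def)
  have "congruent (syn_rel A L) (\<lambda>s. C (hole @ embed s))"
    unfolding C_def by (auto intro!: congruentI equiv_class_eq[OF eC] embed_syn_rel)
  then show "add_right F (R s) = C (hole @ embed s)" if "s \<in> forests A"
    using UN_equiv_class[OF eR _ that] by (simp add: C_def R_def F_def syntactic_alg_def)
qed

lemma forest_algebra_syntactic: "forest_algebra (syntactic_alg A L)"
proof (rule forest_algebra.intro)
  note simps = syntactic_alg_carrier syntactic_alg_simps plug_comp_ctxt
  show "monoid (Hor (syntactic_alg A L))"
    by (intro monoidI) (auto simp: simps)
  show "monoid (Ver (syntactic_alg A L))"
    by (intro monoidI) (auto simp: simps comp_ctxt_assoc)
  fix v w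
  assume "v \<in> carrier (Ver (syntactic_alg A L))" "w \<in> carrier (Ver (syntactic_alg A L))"
    and eq: "\<And>h. h \<in> carrier (Hor (syntactic_alg A L)) \<Longrightarrow>
      act (syntactic_alg A L) v h = act (syntactic_alg A L) w h"
  then obtain p q where pq: "p \<in> contexts A" "q \<in> contexts A"
    "v = syn_rel_ctxt A L `` {p}" "w = syn_rel_ctxt A L `` {q}"
    by (auto simp: simps)
  have "(plug p s, plug q s) \<in> syn_rel A L" if "s \<in> forests A" for s
    using eq[of "syn_rel A L `` {s}"] that pq
    by (simp add: simps eq_equiv_class_iff[OF equiv_syn_rel])
  with pq(1,2) have "(p, q) \<in> syn_rel_ctxt A L"
    by (simp add: syn_rel_ctxt_def)
  then show "v = w"
    unfolding pq(3,4) by (rule equiv_class_eq[OF equiv_syn_rel_ctxt])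
qed (elim syntactic_algE; simp add: syntactic_alg_simps syntactic_alg_closed plug_comp_ctxt)+

lemma syntactic_morphism:
  "forest_alg_morphism (free_forest_alg A) (syntactic_alg A L)
     (\<lambda>s. syn_rel A L `` {s}) (\<lambda>p. syn_rel_ctxt A L `` {p})"
  by (simp add: forest_alg_morphism_def hom_def syntactic_alg_simps syntactic_alg_closed
      free_forest_alg_def)

end

theory Submission
  imports Defs
begin

text \<open>
  Necessity: a piece of \<open>p (q\<^sup>k\<^sup>+\<^sup>1 s)\<close> with at most \<open>k\<close> nodes misses one of the factors \<open>q\<close>
  entirely, so it is a piece of \<open>p (q\<^sup>k s)\<close>.

  Sufficiency: colour forests by their syntactic class. The main point is a uniform bound on the
  number of colour changes along chains of pieces \<open>s\<^sub>0 \<preceq>\<^sub>p s\<^sub>1 \<preceq>\<^sub>p \<dots>\<close>. Call the colours of the pieces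
  of \<open>t\<close> its types; they increase along a chain, so one can induct on their number. If in the
  first-child/next-sibling tree of \<open>t\<close> a node and one of its descendants have the same colour, and
  both children of the upper node have all the types of \<open>t\<close>, then the identity makes \<open>t\<close> absorb all
  its pieces; such a colour is determined by the set of types. Otherwise the nodes both of whose
  children have all the types form a tree of bounded height, so \<open>t\<close> is built from boundedly many
  paths whose side forests have fewer types. Changes along a path are bounded by the same argument
  for words of contexts, where repetition of a suffix colour replaces branching.
  Finally, between a small piece of \<open>t\<close> and \<open>t\<close> there is always a piece of bounded size with the
  colour of \<open>t\<close>, so two forests of different colours with the same small pieces would give rise to
  a long chain of alternating colours.
\<close>

section \<open>Pieces and words of contexts\<close>

text \<open>Structural form of deletion: each root of the target is either kept, or replaced by what
  survives of its children. Unlike sequences of deletions, it can be inverted along the target;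
  \<open>piece_emb\<close> identifies the two.\<close>

inductive emb :: "'a forest \<Rightarrow> 'a forest \<Rightarrow> bool" where
  Nil: "emb [] []"
| keep: "emb s t \<Longrightarrow> emb s' t' \<Longrightarrow> emb (Node a s # s') (Node a t # t')"
| skip: "emb s t \<Longrightarrow> emb s' t' \<Longrightarrow> emb (s @ s') (Node a t # t')"

lemma emb_Nil_right: "emb s [] \<longleftrightarrow> s = []"
  by (auto intro: emb.Nil elim: emb.cases)

lemma emb_Cons: "emb s (Node a us # ts) \<longleftrightarrow>
  (\<exists>us' ts'. emb us' us \<and> emb ts' ts \<and> (s = Node a us' # ts' \<or> s = us' @ ts'))"
proof
  assume "emb s (Node a us # ts)"
  then show "\<exists>us' ts'. emb us' us \<and> emb ts' ts \<and> (s = Node a us' # ts' \<or> s = us' @ ts')"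
    by cases blast+
qed (auto intro: emb.keep emb.skip)

lemma emb_Nil_left: "emb [] t"
proof (induction t rule: labels.induct)
  case (2 a us ts)
  then show ?case using emb.skip[of "[]" us "[]" ts a] by simp
qed (rule emb.Nil)

lemma emb_refl: "emb t t"
  by (induction t rule: labels.induct) (auto intro: emb.intros)

lemma emb_append: "emb s t \<Longrightarrow> emb s' t' \<Longrightarrow> emb (s @ s') (t @ t')"
proof (induction rule: emb.induct)
  case (skip s t s'' t'' a)
  then show ?case using emb.skip[of s t "s'' @ s'" "t'' @ t'" a] by simp
qed (auto intro: emb.intros)

lemma emb_appendE:
  assumes "emb s (t @ t')"
  obtains r r' where "s = r @ r'" "emb r t" "emb r' t'"
  using assms
proof (induction t arbitrary: s thesis rule: labels.induct)
  case 1
  show ?case by (rule 1(1)[of "[]" s]) (use 1 emb.Nil in auto)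
next
  case (2 a us ts)
  obtain us' vs where uv: "emb us' us" "emb vs (ts @ t')" "s = Node a us' # vs \<or> s = us' @ vs"
    using 2(4) by (auto simp: emb_Cons)
  from 2(2)[OF _ uv(2)] obtain r r' where r: "vs = r @ r'" "emb r ts" "emb r' t'" by blast
  from uv(3) show ?case
  proof
    assume "s = Node a us' # vs"
    then show ?thesis using 2(3)[of "Node a us' # r" r'] r uv(1) by (auto intro: emb.keep)
  next
    assume "s = us' @ vs"
    then show ?thesis using 2(3)[of "us' @ r" r'] r uv(1) by (auto intro: emb.skip)
  qed
qed

lemma emb_trans: "emb s t \<Longrightarrow> emb r s \<Longrightarrow> emb r t"
proof (induction arbitrary: r rule: emb.induct)
  case (keep s t s' t' a)
  then show ?case by (fastforce simp: emb_Cons)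
next
  case (skip s t s' t' a)
  then show ?case by (metis emb_appendE emb.skip)
qed

lemma delete_node_append:
  "delete_node t s \<Longrightarrow> delete_node (xs @ t @ ys) (xs @ s @ ys)"
proof (induction rule: delete_node.induct)
  case (here xs' a us ys')
  then show ?case using delete_node.here[of "xs @ xs'" a us "ys' @ ys"] by simp
next
  case (below us vs xs' a ys')
  then show ?case using delete_node.below[of us vs "xs @ xs'" a "ys' @ ys"] by simp
qed

lemma delete_node_emb: "delete_node t s \<Longrightarrow> emb s t"
proof (induction rule: delete_node.induct)
  case (here xs a us ys)
  then show ?case by (intro emb_append emb.skip emb_refl)
next
  case (below us vs xs a ys)
  then show ?case by (intro emb_append emb.keep emb_refl)
qed

lemma piece_trans: "r \<preceq>\<^sub>p s \<Longrightarrow> s \<preceq>\<^sub>p t \<Longrightarrow> r \<preceq>\<^sub>p t"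
  by (auto simp: piece_def)

lemma piece_context: "s \<preceq>\<^sub>p t \<Longrightarrow> xs @ s @ ys \<preceq>\<^sub>p xs @ t @ ys"
  unfolding piece_def
  by (induction rule: rtranclp_induct) (auto intro: rtranclp.rtrancl_into_rtrancl delete_node_append)

lemma piece_below: "s \<preceq>\<^sub>p t \<Longrightarrow> Node a s # ts \<preceq>\<^sub>p Node a t # ts"
  unfolding piece_def
proof (induction rule: rtranclp_induct)
  case (step y z)
  then show ?case
    using delete_node.below[of y z "[]" a ts] by (auto intro: rtranclp.rtrancl_into_rtrancl)
qed simp

text \<open>Successive deletions compose because \<open>emb\<close> is transitive. Conversely, a
  derivation of \<open>emb\<close> unfolds into deletions: a skipped root is removed first, then its
  children and its later siblings are reduced separately.\<close>

lemma piece_emb: "s \<preceq>\<^sub>p t \<longleftrightarrow> emb s t"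
proof
  show "s \<preceq>\<^sub>p t \<Longrightarrow> emb s t"
    unfolding piece_def
    by (induction rule: rtranclp_induct) (auto intro: emb_refl emb_trans delete_node_emb)
  show "emb s t \<Longrightarrow> s \<preceq>\<^sub>p t"
  proof (induction rule: emb.induct)
    case Nil
    then show ?case by (simp add: piece_def)
  next
    case (keep s t s' t' a)
    then show ?case
      using piece_trans[OF piece_below[of s t a s'], of "Node a t # t'"]
        piece_context[of s' t' "[Node a t]" "[]"] by simp
  next
    case (skip s t s' t' a)
    have "delete_node (Node a t # t') (t @ t')" using delete_node.here[of "[]" a t t'] by simp
    then have "t @ t' \<preceq>\<^sub>p Node a t # t'" by (simp add: piece_def)
    then show ?case
      using piece_context[OF skip(3), of "[]" s'] piece_context[OF skip(4), of t "[]"]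
      by (auto intro: piece_trans)
  qed
qed

lemmas piece_refl [simp] = emb_refl[folded piece_emb]
  and piece_Nil_left [simp] = emb_Nil_left[folded piece_emb]
  and piece_Nil_right [simp] = emb_Nil_right[folded piece_emb]
  and piece_Cons = emb_Cons[folded piece_emb]
  and piece_append = emb_append[folded piece_emb]
  and piece_appendE = emb_appendE[folded piece_emb]
  and piece_keep = emb.keep[folded piece_emb]
  and piece_skip = emb.skip[folded piece_emb]

lemma labels_eq_Nil: "labels t = [] \<longleftrightarrow> t = []"
  by (cases t rule: labels.cases) auto

text \<open>The letter \<open>(f, x, g)\<close> stands for the context \<open>f + x\<box> + g\<close>, or \<open>f + \<box> + g\<close> if \<open>x\<close> is
  \<^term>\<open>None\<close>, and a word for the composition of its letters. A letter that is deleted leaves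
  \<^term>\<open>([], None, [])\<close> behind, so that words related by \<open>word_le\<close> have the same length.\<close>

type_synonym 'a letter = "'a forest \<times> 'a option \<times> 'a forest"

fun app_letter :: "'a letter \<Rightarrow> 'a forest \<Rightarrow> 'a forest" where
  "app_letter (f, None, g) s = f @ s @ g"
| "app_letter (f, Some a, g) s = f @ Node a s # g"

abbreviation app :: "'a letter list \<Rightarrow> 'a forest \<Rightarrow> 'a forest" where
  "app w s \<equiv> foldr app_letter w s"

fun letter_le :: "'a letter \<Rightarrow> 'a letter \<Rightarrow> bool" where
  "letter_le (f, x, g) (f', x', g') \<longleftrightarrow> f \<preceq>\<^sub>p f' \<and> (x = None \<or> x = x') \<and> g \<preceq>\<^sub>p g'"

abbreviation word_le :: "'a letter list \<Rightarrow> 'a letter list \<Rightarrow> bool" where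
  "word_le \<equiv> list_all2 letter_le"

abbreviation word_pow :: "nat \<Rightarrow> 'a letter list \<Rightarrow> 'a letter list" where
  "word_pow n w \<equiv> concat (replicate n w)"

lemma letter_le_refl [simp]: "letter_le x x"
  by (cases x) auto

lemma letter_le_trans: "letter_le x y \<Longrightarrow> letter_le y z \<Longrightarrow> letter_le x z"
  by (cases x; cases y; cases z) (auto intro: piece_trans)

lemma word_le_refl [simp]: "word_le w w"
  by (simp add: list_all2_refl)

lemma word_le_trans: "word_le u v \<Longrightarrow> word_le v w \<Longrightarrow> word_le u w"
  by (rule list_all2_trans[OF letter_le_trans])

lemma word_le_append: "word_le u v \<Longrightarrow> word_le u' v' \<Longrightarrow> word_le (u @ u') (v @ v')"
  by (rule list_all2_appendI)

lemma app_letter_mono: "letter_le x y \<Longrightarrow> s \<preceq>\<^sub>p t \<Longrightarrow> app_letter x s \<preceq>\<^sub>p app_letter y t"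
  by (cases "(x, s)" rule: app_letter.cases; cases "(y, t)" rule: app_letter.cases)
    (auto intro!: piece_append piece_keep piece_skip)

lemma app_mono: "word_le u v \<Longrightarrow> s \<preceq>\<^sub>p t \<Longrightarrow> app u s \<preceq>\<^sub>p app v t"
  by (induction rule: list_all2_induct) (auto intro: app_letter_mono)

text \<open>If the node of the letter is deleted, its label becomes \<open>None\<close> and what
  remains of \<open>t\<close> moves up into its place; the side forests shrink
  independently.\<close>

lemma piece_app_letterE:
  assumes "s \<preceq>\<^sub>p app_letter x t"
  obtains y r where "letter_le y x" "r \<preceq>\<^sub>p t" "s = app_letter y r"
proof (cases "(x, t)" rule: app_letter.cases)
  case (1 f g)
  with assms obtain f' r g' where "f' \<preceq>\<^sub>p f" "r \<preceq>\<^sub>p t" "g' \<preceq>\<^sub>p g" "s = f' @ r @ g'"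
    by (auto elim!: piece_appendE)
  then show ?thesis using 1 by (intro that[of "(f', None, g')" r]) auto
next
  case (2 f a g)
  with assms obtain f' r where f: "f' \<preceq>\<^sub>p f" "r \<preceq>\<^sub>p Node a t # g" "s = f' @ r"
    by (auto elim!: piece_appendE)
  then obtain t' g' where "t' \<preceq>\<^sub>p t" "g' \<preceq>\<^sub>p g" "r = Node a t' # g' \<or> r = t' @ g'"
    by (auto simp: piece_Cons)
  then show ?thesis
    using 2 f that[of "(f', Some a, g')" t'] that[of "(f', None, g')" t'] by auto
qed

lemma piece_appE:
  assumes "s \<preceq>\<^sub>p app w t"
  obtains v r where "word_le v w" "r \<preceq>\<^sub>p t" "s = app v r"
  using assms
proof (induction w arbitrary: s thesis)
  case (Cons x w)
  then obtain y r where y: "letter_le y x" "r \<preceq>\<^sub>p app w t" "s = app_letter y r"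
    by (auto elim: piece_app_letterE)
  from Cons.IH[OF _ y(2)] obtain v r' where "word_le v w" "r' \<preceq>\<^sub>p t" "r = app v r'" by blast
  then show ?case using y Cons.prems(1)[of "y # v" r'] by simp
qed simp

text \<open>The least word of the length of \<open>w\<close>; it acts as the identity. Blanking the
  rest of a word turns any of its factors into a word below it.\<close>

definition blank :: "'a letter list \<Rightarrow> 'a letter list" where
  "blank w = replicate (length w) ([], None, [])"

lemma app_blank [simp]: "app (blank w) s = s"
  unfolding blank_def by (induction w) auto

lemma blank_le [simp]: "word_le (blank w) w"
  unfolding blank_def
  by (induction w) (auto simp: split_paired_all)

lemma piece_app: "s \<preceq>\<^sub>p app w s"
  using app_mono[OF blank_le[of w] piece_refl[of s]] by simp

text \<open>Subterms of the first-child/next-sibling encoding.\<close>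

fun subs :: "'a forest \<Rightarrow> 'a forest set" where
  "subs [] = {[]}"
| "subs (Node a us # ts) = insert (Node a us # ts) (subs us \<union> subs ts)"

lemma subs_refl [simp]: "t \<in> subs t"
  by (cases t rule: subs.cases) auto

lemma subs_trans: "r \<in> subs s \<Longrightarrow> s \<in> subs t \<Longrightarrow> r \<in> subs t"
  by (induction t rule: subs.induct) auto

text \<open>The path from \<open>t\<close> down to \<open>s\<close> is read as a word: a first-child
  step contributes the parent with its later siblings, a next-sibling step the tree that is
  passed.\<close>

lemma subs_app: "s \<in> subs t \<Longrightarrow> \<exists>w. t = app w s"
proof (induction t rule: subs.induct)
  case 1
  then show ?case by (auto intro!: exI[of _ "[]"])
next
  case (2 a us ts)
  then consider "s = Node a us # ts" | "s \<in> subs us" | "s \<in> subs ts" by auto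
  then show ?case
  proof cases
    case 1
    then show ?thesis by (auto intro!: exI[of _ "[]"])
  next
    case 2
    then obtain w where "us = app w s" using "2.IH" by blast
    then show ?thesis by (intro exI[of _ "([], Some a, ts) # w"]) simp
  next
    case 3
    then obtain w where "ts = app w s" using "2.IH" by blast
    then show ?thesis by (intro exI[of _ "([Node a us], None, []) # w"]) simp
  qed
qed

lemma subs_piece: "s \<in> subs t \<Longrightarrow> s \<preceq>\<^sub>p t"
  using subs_app piece_app by metis

section \<open>Colour changes along chains\<close>

text \<open>Every chain that ends in \<open>x\<close> has at most \<open>n\<close> colour changes.\<close>

fun alt_bound :: "('x \<Rightarrow> 'x \<Rightarrow> bool) \<Rightarrow> ('x \<Rightarrow> 'c) \<Rightarrow> nat \<Rightarrow> 'x \<Rightarrow> bool" where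
  "alt_bound R col 0 x \<longleftrightarrow> (\<forall>y. R y x \<longrightarrow> col y = col x)"
| "alt_bound R col (Suc n) x \<longleftrightarrow> (\<forall>y. R y x \<longrightarrow> col y \<noteq> col x \<longrightarrow> alt_bound R col n y)"

lemma alt_bound_Suc: "alt_bound R col n x \<Longrightarrow> alt_bound R col (Suc n) x"
  by (induction n arbitrary: x) auto

lemma alt_bound_mono: "alt_bound R col m x \<Longrightarrow> m \<le> n \<Longrightarrow> alt_bound R col n x"
  by (rule dec_induct[of m n]) (blast intro: alt_bound_Suc)+

lemma alt_bound_below:
  assumes "transp R"
  shows "alt_bound R col n x \<Longrightarrow> R y x \<Longrightarrow> alt_bound R col n y"
proof (induction n arbitrary: x y)
  case 0
  then show ?case using transpD[OF assms] by (metis alt_bound.simps(1))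
next
  case (Suc n)
  show ?case
  proof (cases "col y = col x")
    case True
    then show ?thesis using Suc.prems transpD[OF assms] by (metis alt_bound.simps(2))
  next
    case False
    then show ?thesis using Suc.prems alt_bound_Suc by (metis alt_bound.simps(2))
  qed
qed

text \<open>A colour change of the composite forces a change in one of its coordinates. This uses up
  one unit of that coordinate's bound, while the other bound is inherited by the smaller
  element.\<close>

lemma alt_bound_comp:
  assumes trans: "transp R1" "transp R2"
    and split: "\<And>x y z. R z (f x y) \<Longrightarrow> \<exists>x' y'. z = f x' y' \<and> R1 x' x \<and> R2 y' y"
    and col: "\<And>x y x' y'. col1 x = col1 x' \<Longrightarrow> col2 y = col2 y' \<Longrightarrow> col (f x y) = col (f x' y')"
  shows "alt_bound R1 col1 m x \<Longrightarrow> alt_bound R2 col2 n y \<Longrightarrow> alt_bound R col (m + n) (f x y)"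
proof (induction "m + n" arbitrary: m n x y)
  case 0
  have "col z = col (f x y)" if z: "R z (f x y)" for z
  proof -
    obtain x' y' where xy: "z = f x' y'" "R1 x' x" "R2 y' y" using split[OF z] by blast
    then show ?thesis using 0 unfolding xy(1) by (intro col) auto
  qed
  then show ?case using 0 by simp
next
  case (Suc k)
  have "alt_bound R col k z" if z: "R z (f x y)" "col z \<noteq> col (f x y)" for z
  proof -
    obtain x' y' where xy: "z = f x' y'" "R1 x' x" "R2 y' y" using split z(1) by blast
    have below: "alt_bound R1 col1 m x'" "alt_bound R2 col2 n y'"
      using alt_bound_below[OF trans(1) Suc.prems(1) xy(2)] alt_bound_below[OF trans(2) Suc.prems(2) xy(3)]
      by blast+
    show ?thesis
    proof (cases "col1 x' = col1 x")
      case True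
      then have "col2 y' \<noteq> col2 y" using col z(2) xy(1) by metis
      then obtain n' where n': "n = Suc n'" "alt_bound R2 col2 n' y'"
        using Suc.prems(2) xy(3) by (cases n) auto
      have "k = m + n'" using Suc.hyps(2) n' by simp
      then show ?thesis using Suc.hyps(1)[of m n' x' y'] below n' xy by simp
    next
      case False
      then obtain m' where m': "m = Suc m'" "alt_bound R1 col1 m' x'"
        using Suc.prems(1) xy(2) by (cases m) auto
      have "k = m' + n" using Suc.hyps(2) m' by simp
      then show ?thesis using Suc.hyps(1)[of m' n x' y'] below m' xy by simp
    qed
  qed
  then show ?case using Suc.hyps(2)[symmetric] by simp
qed

section \<open>Absorbing colourings\<close>

lemma transp_piece: "transp piece"
  by (rule transpI) (rule piece_trans)

lemma transp_word_le: "transp word_le"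
  by (rule transpI) (rule word_le_trans)

text \<open>The two absorption laws are the identity of the theorem for contexts written as words,
  with \<open>om\<close> in the role of \<omega>. By \<open>cong\<close> words act on colours, and
  finiteness of the range stands for regularity.\<close>

locale absorbing_colouring =
  fixes col :: "'a forest \<Rightarrow> 'c" and om :: nat
  assumes finite_range: "finite (range col)"
    and cong: "col s = col t \<Longrightarrow> col (app w s) = col (app w t)"
    and absorb_right: "word_le v w \<Longrightarrow>
      col (app (word_pow om w) (app v s)) = col (app (word_pow om w) s)"
    and absorb_left: "word_le v w \<Longrightarrow>
      col (app v (app (word_pow om w) s)) = col (app (word_pow om w) s)"
begin

text \<open>The map that \<open>w\<close> induces on colours, given by its graph.\<close>

definition wcol :: "'a letter list \<Rightarrow> ('c \<times> 'c) set" where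
  "wcol w = range (\<lambda>s. (col s, col (app w s)))"

text \<open>By \<open>cong\<close> the graph is functional, so a pair of one graph found in the
  other has the right second component, even if it stems from another forest of the same
  colour.\<close>

lemma wcol_eq_iff: "wcol v = wcol w \<longleftrightarrow> (\<forall>s. col (app v s) = col (app w s))"
proof
  assume eq: "wcol v = wcol w"
  show "\<forall>s. col (app v s) = col (app w s)"
  proof
    fix s
    have "(col s, col (app v s)) \<in> wcol v" unfolding wcol_def by (rule rangeI)
    then have "(col s, col (app v s)) \<in> wcol w" unfolding eq .
    then obtain s' where "(col s, col (app v s)) = (col s', col (app w s'))"
      unfolding wcol_def by (rule rangeE)
    then show "col (app v s) = col (app w s)" using cong[of s s' w] by simp
  qed
next
  assume "\<forall>s. col (app v s) = col (app w s)"
  then show "wcol v = wcol w" unfolding wcol_def by (intro image_cong) auto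
qed

lemma finite_range_wcol: "finite (range wcol)"
proof (rule finite_subset)
  show "range wcol \<subseteq> Pow (range col \<times> range col)" by (auto simp: wcol_def)
qed (simp add: finite_range)

lemma col_app:
  assumes "wcol u = wcol u'" "col s = col s'"
  shows "col (app u s) = col (app u' s')"
proof -
  have "col (app u s) = col (app u' s)" using assms(1) by (simp add: wcol_eq_iff)
  also have "\<dots> = col (app u' s')" by (rule cong[OF assms(2)])
  finally show ?thesis .
qed

lemma wcol_append:
  assumes "wcol u = wcol u'" "wcol v = wcol v'"
  shows "wcol (u @ v) = wcol (u' @ v')"
proof -
  have "col (app v s) = col (app v' s)" for s using assms(2) by (simp add: wcol_eq_iff)
  from col_app[OF assms(1) this] show ?thesis by (subst wcol_eq_iff) simp
qed

section \<open>Types of forests and of words\<close>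

definition types :: "'a forest \<Rightarrow> 'c set" where
  "types t = col ` {s. s \<preceq>\<^sub>p t}"

definition wtypes :: "'a letter list \<Rightarrow> ('c \<times> 'c) set set" where
  "wtypes w = wcol ` {v. word_le v w}"

lemma typesI: "s \<preceq>\<^sub>p t \<Longrightarrow> col s \<in> types t"
  unfolding types_def by blast

lemma typesE:
  assumes "e \<in> types t"
  obtains s where "s \<preceq>\<^sub>p t" "col s = e"
  using assms unfolding types_def by blast

lemma wtypesI: "word_le v w \<Longrightarrow> wcol v \<in> wtypes w"
  unfolding wtypes_def by blast

lemma wtypesE:
  assumes "e \<in> wtypes w"
  obtains v where "word_le v w" "wcol v = e"
  using assms unfolding wtypes_def by blast

lemma types_mono: "s \<preceq>\<^sub>p t \<Longrightarrow> types s \<subseteq> types t"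
  unfolding types_def by (intro image_mono Collect_mono impI) (rule piece_trans)

lemma wtypes_mono: "word_le v w \<Longrightarrow> wtypes v \<subseteq> wtypes w"
  unfolding wtypes_def by (intro image_mono Collect_mono impI) (rule word_le_trans)

lemma finite_types [simp]: "finite (types t)"
  by (rule finite_subset[OF _ finite_range]) (auto simp: types_def)

lemma finite_wtypes [simp]: "finite (wtypes w)"
  by (rule finite_subset[OF _ finite_range_wcol]) (auto simp: wtypes_def)

lemma types_self [simp]: "col t \<in> types t"
  by (auto simp: types_def)

lemma wtypes_self [simp]: "wcol w \<in> wtypes w"
  by (auto simp: wtypes_def)

section \<open>Composing bounds on colour changes\<close>

abbreviation bound :: "nat \<Rightarrow> 'a forest \<Rightarrow> bool" where
  "bound \<equiv> alt_bound piece col"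

abbreviation wbound :: "nat \<Rightarrow> 'a letter list \<Rightarrow> bool" where
  "wbound \<equiv> alt_bound word_le wcol"

lemma bound_below: "bound n t \<Longrightarrow> s \<preceq>\<^sub>p t \<Longrightarrow> bound n s"
  by (rule alt_bound_below[OF transp_piece])

lemma bound_app:
  assumes "wbound m w" "bound n t"
  shows "bound (m + n) (app w t)"
proof (rule alt_bound_comp[OF transp_word_le transp_piece _ _ assms])
  show "\<exists>w' t'. s = app w' t' \<and> word_le w' w \<and> t' \<preceq>\<^sub>p t" if "s \<preceq>\<^sub>p app w t" for s w t
    using piece_appE[OF that] by metis
qed (rule col_app)

lemma wbound_append:
  assumes "wbound m u" "wbound n v"
  shows "wbound (m + n) (u @ v)"
  by (rule alt_bound_comp[OF transp_word_le transp_word_le _ _ assms])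
    (fastforce simp: list_all2_append2, rule wcol_append)

lemma bound_Nil: "bound 0 []"
  by simp

lemma wbound_Nil: "wbound 0 []"
  by simp

text \<open>A change of the letter changes the colour of \<open>f\<close>, the label or the colour
  of \<open>g\<close>. The label can only drop to \<open>None\<close>, hence changes at most once;
  this is the \<open>Suc\<close>.\<close>

lemma wbound_letter:
  assumes "bound m f" "bound n g"
  shows "wbound (m + Suc n) [(f, x, g)]"
proof -
  let ?opt_le = "\<lambda>x y :: 'a option. x = None \<or> x = y"
  let ?le = "\<lambda>(x, g) (y, h). ?opt_le x y \<and> g \<preceq>\<^sub>p h"
  let ?col = "\<lambda>(x, g). (x, col g)"
  have x: "alt_bound ?opt_le (\<lambda>x. x) (Suc 0) x" by auto
  have inner: "alt_bound ?le ?col (Suc 0 + n) (x, g)"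
    by (rule alt_bound_comp[where f = Pair, OF _ transp_piece _ _ x assms(2)])
      (auto intro!: transpI)
  have cg: "col (f @ s) = col (f' @ s')" if "col f = col f'" "col s = col s'" for f f' s s'
    using cong[OF that(1), of "[([], None, s)]"] cong[OF that(2), of "[(f', None, [])]"] by simp
  have "wbound (m + (Suc 0 + n)) ((\<lambda>f (x, g). [(f, x, g)]) f (x, g))"
  proof (rule alt_bound_comp[OF transp_piece _ _ _ assms(1) inner])
    show "transp ?le"
      by (rule transpI) (use piece_trans in blast)
    show "\<exists>x' y'. z = (\<lambda>f (x, g). [(f, x, g)]) x' y' \<and> x' \<preceq>\<^sub>p f \<and> ?le y' xg"
      if "word_le z ((\<lambda>f (x, g). [(f, x, g)]) f xg)" for z f xg
      using that by (cases xg) (auto simp: list_all2_Cons2)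
    show "wcol ((\<lambda>f (x, g). [(f, x, g)]) f y) = wcol ((\<lambda>f (x, g). [(f, x, g)]) f' y')"
      if f: "col f = col f'" and y: "?col y = ?col y'" for f f' y y'
    proof (cases y; cases y')
      fix x g x' g' assume [simp]: "y = (x, g)" "y' = (x', g')"
      \<comment> \<open>The first instance of \<open>cg\<close> serves the label
        \<open>None\<close>, the second an actual label; only there does \<open>the x\<close>
        matter.\<close>
      have inner: "col (app_letter ([], x, g) s) = col (app_letter ([], x, g') s)" for s
        using cg[of s s g g'] cg[of "[Node (the x) s]" "[Node (the x) s]" g g'] y
        by (cases x) auto
      have rep: "app_letter (f, x, g) s = f @ app_letter ([], x, g) s" for f x g s
        by (cases x) auto
      have "col (app_letter (f, x, g) s) = col (app_letter (f', x', g') s)" for s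
        unfolding rep[of f] rep[of f'] using y inner[of s] by (intro cg f) auto
      then show ?thesis by (simp add: wcol_eq_iff)
    qed
  qed
  then show ?thesis by simp
qed

text \<open>The forest is the letter \<open>([], Some a, ts)\<close> applied to \<open>us\<close>;
  the extra one accounts for the label.\<close>

lemma bound_Node:
  assumes "bound m us" "bound n ts"
  shows "bound (Suc n + m) (Node a us # ts)"
  using bound_app[OF wbound_letter[OF bound_Nil assms(2), of "Some a"] assms(1)] by simp

text \<open>If \<open>u\<close> fixes a colour then so does \<open>u\<^sup>\<omega>\<close>, which absorbs the pieces of \<open>u\<close>.\<close>

lemma fixed_absorbs:
  assumes fix_u: "col (app u s) = col s" and "word_le v u"
  shows "col (app v s) = col s"
proof -
  have pow: "col (app (word_pow k u) s) = col s" for k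
  proof (induction k)
    case (Suc k)
    then show ?case using cong[OF Suc, of u] fix_u by simp
  qed simp
  have "col (app v s) = col (app v (app (word_pow om u) s))" by (rule cong) (simp add: pow)
  also have "\<dots> = col s" using absorb_left[OF assms(2)] pow by simp
  finally show ?thesis .
qed

text \<open>The word \<open>u @ v\<close> fixes the colour of \<open>s\<close>, hence so does its
  piece in which \<open>u\<close> is blanked. Thus colours that can be reached from each other by
  words coincide.\<close>

lemma col_antisym:
  assumes "col (app u (app v s)) = col s"
  shows "col (app v s) = col s"
  using fixed_absorbs[of "u @ v" s "blank u @ v"] assms by (simp add: word_le_append)

text \<open>The mirror image of \<open>fixed_absorbs\<close>: if \<open>w\<close> is unchanged by
  \<open>u\<close> on the right, it is unchanged by all powers of \<open>u\<close>, and the power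
  \<open>om\<close> absorbs \<open>v\<close> by \<open>absorb_right\<close>.\<close>

lemma wfixed_absorbs:
  assumes fix_u: "wcol (w @ u) = wcol w" and "word_le v u"
  shows "wcol (w @ v) = wcol w"
proof -
  have pow: "col (app w (app (word_pow k u) s)) = col (app w s)" for k s
  proof (induction k arbitrary: s)
    case (Suc k)
    have "col (app w (app (word_pow (Suc k) u) s)) = col (app w (app (word_pow k u) s))"
      using fix_u by (simp add: wcol_eq_iff)
    then show ?case using Suc by simp
  qed simp
  have "col (app w (app v s)) = col (app w s)" for s
  proof -
    have "col (app w (app v s)) = col (app w (app (word_pow om u) (app v s)))" by (simp add: pow)
    also have "\<dots> = col (app w (app (word_pow om u) s))"
      by (rule cong) (rule absorb_right[OF assms(2)])
    finally show ?thesis by (simp add: pow)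
  qed
  then show ?thesis by (simp add: wcol_eq_iff)
qed

section \<open>Words that absorb their pieces\<close>

text \<open>Among the maps induced by words below \<open>w\<close>, the map of \<open>w\<close> is a
  two-sided zero.\<close>

definition wzero :: "'a letter list \<Rightarrow> bool" where
  "wzero w \<longleftrightarrow> (\<forall>v. word_le v w \<longrightarrow> wcol (v @ w) = wcol w \<and> wcol (w @ v) = wcol w)"

text \<open>The usual uniqueness of a zero: as the types agree, each word has a copy of its colour
  below the other, and the product of the two colours equals both.\<close>

lemma wzero_unique:
  assumes "wzero v" "wzero w" "wtypes v = wtypes w"
  shows "wcol v = wcol w"
proof -
  obtain w' where w': "word_le w' v" "wcol w' = wcol w"
    using wtypes_self[of w] unfolding assms(3)[symmetric] by (rule wtypesE)
  obtain v' where v': "word_le v' w" "wcol v' = wcol v"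
    using wtypes_self[of v] unfolding assms(3) by (rule wtypesE)
  have "wcol v = wcol (v @ w')" using assms(1) w'(1) by (simp add: wzero_def)
  also have "\<dots> = wcol (v' @ w)" using wcol_append[OF v'(2)[symmetric] w'(2)] .
  also have "\<dots> = wcol w" using assms(2) v'(1) by (simp add: wzero_def)
  finally show ?thesis .
qed

text \<open>Left absorption shows that \<open>w @ v @ w\<close> has the colour of \<open>w\<close>,
  so \<open>w\<close> is fixed on the right by \<open>v @ w\<close> and therefore by its piece
  \<open>v\<close>.\<close>

lemma wzeroI:
  assumes left: "\<And>v. word_le v w \<Longrightarrow> wcol (v @ w) = wcol w"
  shows "wzero w"
proof -
  have "wcol (w @ v) = wcol w" if "word_le v w" for v
  proof -
    have "wcol (w @ v @ w) = wcol (w @ w)" by (rule wcol_append[OF refl left[OF that]])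
    then have "wcol (w @ v @ w) = wcol w" using left[of w] by simp
    from wfixed_absorbs[OF this, of "v @ blank w"] show ?thesis
      by (simp add: word_le_append that wcol_eq_iff)
  qed
  then show ?thesis using left by (auto simp: wzero_def)
qed

text \<open>Every piece of \<open>w\<close> has the colour of a piece of \<open>v\<close>, so it is absorbed by \<open>r\<close>.\<close>

lemma wzero_repeat:
  assumes w: "w = c @ v @ r" and types: "wtypes v = wtypes w" and eq: "wcol (v @ r) = wcol r"
  shows "wzero w"
proof (rule wzeroI)
  have absorb: "wcol (p @ r) = wcol r" if p: "word_le p w" for p
  proof -
    obtain p' where p': "word_le p' v" "wcol p' = wcol p"
      using wtypesI[OF p] unfolding types[symmetric] by (rule wtypesE)
    have "col (app p' (app r s)) = col (app r s)" for s
      by (rule fixed_absorbs[OF _ p'(1)]) (use eq in \<open>simp add: wcol_eq_iff\<close>)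
    then show ?thesis using p'(2) by (auto simp: wcol_eq_iff)
  qed
  \<comment> \<open>The piece that keeps only \<open>c\<close> is absorbed as well, so
    \<open>w = c @ v @ r\<close> has the colour of \<open>r\<close>.\<close>
  have "word_le (c @ blank (v @ r)) w" unfolding w by (intro word_le_append) auto
  from absorb[OF this] have "wcol (c @ r) = wcol r" by (simp add: wcol_eq_iff)
  then have "wcol w = wcol r" using eq by (simp add: w wcol_eq_iff) (metis cong)
  then show "wcol (p @ w) = wcol w" if "word_le p w" for p
    using absorb[OF that] wcol_append[of p p w r] by simp
qed


section \<open>Uniform bounds for words\<close>

text \<open>Only the colour changes of the side forests are controlled, not the length of the word;
  \<open>wbound_exists\<close> shows that this suffices.\<close>

definition sides_bounded :: "nat \<Rightarrow> 'a letter list \<Rightarrow> bool" where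
  "sides_bounded n w \<longleftrightarrow> (\<forall>(f, x, g) \<in> set w. bound n f \<and> bound n g)"

lemma sides_bounded_append:
  "sides_bounded n (u @ v) \<longleftrightarrow> sides_bounded n u \<and> sides_bounded n v"
  by (simp add: sides_bounded_def ball_Un)

lemma sides_bounded_Cons:
  "sides_bounded n ((f, x, g) # w) \<longleftrightarrow> bound n f \<and> bound n g \<and> sides_bounded n w"
  by (auto simp: sides_bounded_def)

lemma sides_bounded_below: "word_le v w \<Longrightarrow> sides_bounded n w \<Longrightarrow> sides_bounded n v"
proof (induction rule: list_all2_induct)
  case (Cons x v y w)
  obtain f a g f' a' g' where xy: "x = (f, a, g)" "y = (f', a', g')" by (cases x; cases y)
  with Cons show ?case
    using bound_below[of n f' f] bound_below[of n g' g] by (simp add: sides_bounded_Cons)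
qed simp

lemma wtypes_factor: "wtypes v \<subseteq> wtypes (c @ v @ r)"
proof
  fix e assume "e \<in> wtypes v"
  then obtain p where p: "word_le p v" "wcol p = e" by (rule wtypesE)
  then have "word_le (blank c @ p @ blank r) (c @ v @ r)" by (intro word_le_append) auto
  moreover have "wcol (blank c @ p @ blank r) = wcol p" by (simp add: wcol_eq_iff)
  ultimately show "e \<in> wtypes (c @ v @ r)" using wtypesI p(2) by metis
qed

lemma wtypes_less: "wtypes u \<subseteq> wtypes w \<Longrightarrow> wtypes u \<noteq> wtypes w \<Longrightarrow> card (wtypes w) \<le> Suc k \<Longrightarrow>
    card (wtypes u) \<le> k"
  by (meson finite_wtypes less_Suc_eq_le order_less_le_trans psubsetI psubset_card_mono)

lemma types_less: "types u \<subseteq> types w \<Longrightarrow> types u \<noteq> types w \<Longrightarrow> card (types w) \<le> Suc k \<Longrightarrow>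
    card (types u) \<le> k"
  by (meson finite_types less_Suc_eq_le order_less_le_trans psubsetI psubset_card_mono)

text \<open>Cut after the shortest nonempty prefix that has all the types. By \<open>wzero_repeat\<close> the colour of
  \<open>w\<close> does not occur among the suffixes of what remains, so the number of cuts is bounded.\<close>

lemma nonzero_wbound:
  assumes N: "\<And>w. sides_bounded n w \<Longrightarrow> card (wtypes w) \<le> k \<Longrightarrow> wbound N w"
  shows "\<exists>B. \<forall>c u. sides_bounded n (c @ u) \<longrightarrow> card (wtypes (c @ u)) \<le> Suc k \<longrightarrow> \<not> wzero (c @ u) \<longrightarrow>
    card (wcol ` {r. \<exists>d. u = d @ r}) \<le> i \<longrightarrow> wbound B u"
proof (induction i)
  case 0
  have "\<not> card (wcol ` {r. \<exists>d. u = d @ r}) \<le> 0" for u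
    using finite_subset[OF _ finite_range_wcol, of "wcol ` {r. \<exists>d. u = d @ r}"]
    by (auto simp: card_eq_0_iff)
  then show ?case by blast
next
  case (Suc i)
  then obtain B where B: "\<And>c u. sides_bounded n (c @ u) \<Longrightarrow> card (wtypes (c @ u)) \<le> Suc k \<Longrightarrow>
    \<not> wzero (c @ u) \<Longrightarrow> card (wcol ` {r. \<exists>d. u = d @ r}) \<le> i \<Longrightarrow> wbound B u" by blast
  \<comment> \<open>\<open>N\<close> is for the prefix before the cutting letter,
    \<open>n + Suc n\<close> for that letter, and \<open>B\<close> for the remaining suffix.\<close>
  have "wbound (N + (n + Suc n + B)) u"
    if cu: "sides_bounded n (c @ u)" "card (wtypes (c @ u)) \<le> Suc k" "\<not> wzero (c @ u)"
      "card (wcol ` {r. \<exists>d. u = d @ r}) \<le> Suc i" for c u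
  proof -
    let ?S = "wtypes (c @ u)"
    have le: "wtypes v \<subseteq> ?S" if "u = d @ v @ r" for d v r
      using wtypes_factor[of v "c @ d" r] that by simp
    have small: "wbound N v" if "u = d @ v @ r" "wtypes v \<noteq> ?S" for d v r
      using that cu wtypes_less[OF le[OF that(1)] that(2)]
      by (intro N) (auto simp: sides_bounded_append)
    show ?thesis
    proof (cases "wtypes u = ?S \<and> u \<noteq> []")
      case False
      then have "wbound N u" using small[of "[]" u "[]"] by (auto intro: alt_bound_mono[OF wbound_Nil])
      then show ?thesis by (rule alt_bound_mono) simp
    next
      case True
      \<comment> \<open>Positivity provides a cutting letter even if the empty prefix already has
        all the types.\<close>
      let ?P = "\<lambda>m. m > 0 \<and> wtypes (take m u) = ?S"
      define m where "m = (LEAST m. ?P m)"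
      have ex: "?P (length u)" using True by simp
      have Pm: "?P m" unfolding m_def by (rule LeastI, rule ex)
      have m_len: "m \<le> length u" unfolding m_def by (rule Least_le, rule ex)
      obtain l where l: "m = Suc l" using Pm by (cases m) auto
      obtain f x g where fxg: "u ! l = (f, x, g)" by (cases "u ! l")
      define d r where "d = take l u" and "r = drop m u"
      have take: "take m u = d @ [(f, x, g)]"
        using m_len l fxg by (simp add: d_def take_Suc_conv_app_nth)
      have u: "u = d @ [(f, x, g)] @ r"
        using take append_take_drop_id[of m u] by (simp add: r_def)
      have "wbound N d"
      proof (cases "d = []")
        case True
        then show ?thesis by (simp add: alt_bound_mono[OF wbound_Nil])
      next
        case False
        then have "l > 0" by (auto simp: d_def)
        then have "wtypes d \<noteq> ?S" using not_less_Least[of l ?P] l by (auto simp: d_def m_def)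
        then show ?thesis using small[of "[]" d] u by simp
      qed
      moreover have "wbound (n + Suc n) [(f, x, g)]"
        using cu(1) unfolding u by (intro wbound_letter) (auto simp: sides_bounded_append sides_bounded_Cons)
      moreover have "wbound B r"
      proof (rule B[of "c @ d @ [(f, x, g)]"])
        have "wcol u \<notin> wcol ` {r'. \<exists>d. r = d @ r'}"
        proof
          assume "wcol u \<in> wcol ` {r'. \<exists>d. r = d @ r'}"
          then obtain e r' where r': "r = e @ r'" "wcol u = wcol r'" by auto
          define v where "v = d @ [(f, x, g)] @ e"
          have v: "u = v @ r'" using u r' by (simp add: v_def)
          have "wtypes v = ?S"
            using Pm take le[of "[]" v r'] v wtypes_factor[of "d @ [(f, x, g)]" "[]" e]
            by (auto simp: v_def)
          then show False using wzero_repeat[of "c @ u" c v r'] v r'(2) cu(3) by simp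
        qed
        moreover have "wcol u \<in> wcol ` {r. \<exists>d. u = d @ r}" by auto
        moreover have "wcol ` {r'. \<exists>d. r = d @ r'} \<subseteq> wcol ` {r. \<exists>d. u = d @ r}"
        proof (intro image_mono subsetI CollectI; elim CollectE exE)
          fix r' e assume "r = e @ r'"
          then show "\<exists>d. u = d @ r'" unfolding u by (intro exI[of _ "d @ [(f, x, g)] @ e"]) simp
        qed
        ultimately have "wcol ` {r'. \<exists>d. r = d @ r'} \<subset> wcol ` {r. \<exists>d. u = d @ r}" by blast
        then have "card (wcol ` {r'. \<exists>d. r = d @ r'}) < card (wcol ` {r. \<exists>d. u = d @ r})"
          by (intro psubset_card_mono finite_subset[OF _ finite_range_wcol]) auto
        then show "card (wcol ` {r'. \<exists>d. r = d @ r'}) \<le> i" using cu(4) by simp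
      qed (use cu u in simp_all)
      ultimately show ?thesis unfolding u by (intro wbound_append)
    qed
  qed
  then show ?case by blast
qed

text \<open>Let \<open>w\<close> absorb its pieces. After the first change of colour, which costs
  the \<open>Suc\<close>, a word below \<open>w\<close> either has fewer types, where
  \<open>N\<close> applies, or the same types; then it is not absorbing by
  \<open>wzero_unique\<close>, and \<open>B\<close> applies.\<close>

lemma wbound_exists_card:
  "\<exists>N. \<forall>w. sides_bounded n w \<longrightarrow> card (wtypes w) \<le> k \<longrightarrow> wbound N w"
proof (induction k)
  case 0
  have "card (wtypes w) \<noteq> 0" for w
    using wtypes_self[of w] finite_wtypes[of w] by (metis card_eq_0_iff empty_iff)
  then show ?case by auto
next
  case (Suc k)
  then obtain N where N: "\<And>w. sides_bounded n w \<Longrightarrow> card (wtypes w) \<le> k \<Longrightarrow> wbound N w"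
    by blast
  from nonzero_wbound[OF N, where i = "card (range wcol)"]
  obtain B where B: "\<And>c u. sides_bounded n (c @ u) \<Longrightarrow> card (wtypes (c @ u)) \<le> Suc k \<Longrightarrow>
    \<not> wzero (c @ u) \<Longrightarrow> card (wcol ` {r. \<exists>d. u = d @ r}) \<le> card (range wcol) \<Longrightarrow> wbound B u"
    by blast
  have nz: "wbound B w" if "sides_bounded n w" "card (wtypes w) \<le> Suc k" "\<not> wzero w" for w
    using that B[of "[]" w] card_mono[OF finite_range_wcol, of "wcol ` {r. \<exists>d. w = d @ r}"]
    by (simp add: image_mono)
  have "wbound (Suc (B + N)) w" if w: "sides_bounded n w" "card (wtypes w) \<le> Suc k" for w
  proof (cases "wzero w")
    case False
    then show ?thesis using nz[OF w] by (auto intro: alt_bound_mono simp del: alt_bound.simps)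
  next
    case True
    have "wbound (B + N) v" if v: "word_le v w" "wcol v \<noteq> wcol w" for v
    proof (cases "wtypes v = wtypes w")
      case True
      then have "\<not> wzero v" using wzero_unique[of v w] \<open>wzero w\<close> v(2) by blast
      then have "wbound B v" using nz w v True sides_bounded_below by simp
      then show ?thesis by (rule alt_bound_mono) simp
    next
      case False
      then have "wbound N v"
        using N w v sides_bounded_below wtypes_mono[OF v(1)] wtypes_less by blast
      then show ?thesis by (rule alt_bound_mono) simp
    qed
    then show ?thesis by simp
  qed
  then show ?case by blast
qed

lemma wbound_exists: "\<exists>N. \<forall>w. sides_bounded n w \<longrightarrow> wbound N w"
proof -
  have "card (wtypes w) \<le> card (range wcol)" for w
    by (rule card_mono[OF finite_range_wcol]) (auto simp: wtypes_def)
  then show ?thesis using wbound_exists_card[of n "card (range wcol)"] by blast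
qed

section \<open>Forests that absorb their pieces\<close>

text \<open>The analogue of \<open>wzero\<close> for addition of forests.\<close>

definition fzero :: "'a forest \<Rightarrow> bool" where
  "fzero t \<longleftrightarrow> (\<forall>s. s \<preceq>\<^sub>p t \<longrightarrow> col (s @ t) = col t \<and> col (t @ s) = col t)"

lemma col_append: "col s = col s' \<Longrightarrow> col t = col t' \<Longrightarrow> col (s @ t) = col (s' @ t')"
  using cong[of s s' "[([], None, t)]"] cong[of t t' "[(s', None, [])]"] by simp

lemma col_Node: "col us = col us' \<Longrightarrow> col ts = col ts' \<Longrightarrow>
  col (Node a us # ts) = col (Node a us' # ts')"
  using cong[of us us' "[([], Some a, ts)]"] cong[of ts ts' "[([Node a us'], None, [])]"] by simp

lemma fzero_unique:
  assumes "fzero s" "fzero t" "types s = types t"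
  shows "col s = col t"
proof -
  obtain t' where t': "t' \<preceq>\<^sub>p s" "col t' = col t"
    using types_self[of t] unfolding assms(3)[symmetric] by (rule typesE)
  obtain s' where s': "s' \<preceq>\<^sub>p t" "col s' = col s"
    using types_self[of s] unfolding assms(3) by (rule typesE)
  have "col s = col (s @ t')" using assms(1) t'(1) by (simp add: fzero_def)
  also have "\<dots> = col (s' @ t)" using col_append[OF s'(2)[symmetric] t'(2)] .
  also have "\<dots> = col t" using assms(2) s'(1) by (simp add: fzero_def)
  finally show ?thesis .
qed

text \<open>Left absorption gives \<open>t @ s @ t\<close> the colour of \<open>t\<close>; by
  \<open>col_antisym\<close> the intermediate forest \<open>t @ s\<close> has that colour
  too.\<close>

lemma fzeroI_left:
  assumes left: "\<And>s. s \<preceq>\<^sub>p t \<Longrightarrow> col (s @ t) = col t"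
  shows "fzero t"
proof -
  have "col (t @ s) = col t" if "s \<preceq>\<^sub>p t" for s
  proof (rule col_antisym[of "[([], None, t)]" "[([], None, s)]", simplified])
    have "col (t @ s @ t) = col (t @ t)" by (rule col_append[OF refl left[OF that]])
    then show "col (t @ s @ t) = col t" using left[of t] by simp
  qed
  then show ?thesis using left by (auto simp: fzero_def)
qed

lemma fzeroI_right:
  assumes right: "\<And>s. s \<preceq>\<^sub>p t \<Longrightarrow> col (t @ s) = col t"
  shows "fzero t"
proof -
  have "col (s @ t) = col t" if "s \<preceq>\<^sub>p t" for s
  proof (rule col_antisym[of "[(t, None, [])]" "[(s, None, [])]", simplified])
    have "col ((t @ s) @ t) = col (t @ t)" by (rule col_append[OF right[OF that] refl])
    then show "col (t @ s @ t) = col t" using right[of t] by simp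
  qed
  then show ?thesis using right by (auto simp: fzero_def)
qed

text \<open>The path from the upper node to \<open>x\<close> is a word that fixes the colour of
  \<open>x\<close>, so \<open>x\<close> absorbs the pieces of the branch left aside. As that branch
  has all the types of \<open>t\<close>, every piece of \<open>t\<close> is absorbed: on the right
  if \<open>x\<close> lies below the first child, on the left if it lies below the next
  sibling.\<close>

lemma fzero_branch:
  assumes y: "Node a us # ts \<in> subs t" and types: "types us = types t" "types ts = types t"
    and x: "x \<in> subs us \<union> subs ts" and eq: "col x = col (Node a us # ts)"
  shows "fzero t"
proof -
  let ?y = "Node a us # ts"
  obtain c where c: "t = app c ?y" using subs_app[OF y] by blast
  from x show ?thesis
  proof
    assume "x \<in> subs us"
    then obtain d where d: "us = app d x" using subs_app by blast
    have absorb: "col (x @ g) = col x" if g: "g \<preceq>\<^sub>p t" for g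
    proof -
      obtain g' where g': "g' \<preceq>\<^sub>p ts" "col g' = col g"
        using typesI[OF g] unfolding types(2)[symmetric] by (rule typesE)
      \<comment> \<open>Deleting the label and blanking \<open>d\<close> leaves only the piece
        \<open>g'\<close> of the side forest \<open>ts\<close>.\<close>
      have "col (app (([], None, g') # blank d) x) = col x"
      proof (rule fixed_absorbs)
        show "col (app (([], Some a, ts) # d) x) = col x" by (simp add: d[symmetric] eq)
      qed (use g'(1) in simp)
      then show ?thesis using col_append[OF refl g'(2), of x] by simp
    qed
    have y_absorb: "col (?y @ g) = col ?y" if "g \<preceq>\<^sub>p t" for g
      using absorb[OF that] eq col_append[OF eq refl, of g] by simp
    \<comment> \<open>Since \<open>t\<close> is \<open>app c ?y\<close> and \<open>?y @ t\<close>
      returns to the colour of \<open>?y\<close>, the context \<open>c\<close> does not change that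
      colour.\<close>
    have "col (app c ?y) = col ?y"
      by (rule col_antisym[of "[(?y, None, [])]"]) (use y_absorb[of t] in \<open>simp add: c[symmetric]\<close>)
    then have "col t = col ?y" by (simp only: c[symmetric])
    show ?thesis
    proof (rule fzeroI_right)
      fix g assume "g \<preceq>\<^sub>p t"
      then show "col (t @ g) = col t"
        using y_absorb[of g] col_append[OF \<open>col t = col ?y\<close> refl, of g] \<open>col t = col ?y\<close> by simp
    qed
  next
    assume "x \<in> subs ts"
    then obtain d where d: "ts = app d x" using subs_app by blast
    have absorb: "col (g @ x) = col x" if g: "g \<preceq>\<^sub>p t" for g
    proof -
      obtain g' where g': "g' \<preceq>\<^sub>p us" "col g' = col g"
        using typesI[OF g] unfolding types(1)[symmetric] by (rule typesE)
      have "g' \<preceq>\<^sub>p [Node a us]" using g'(1) piece_skip[of g' us "[]" "[]" a] by simp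
      have "col (app ((g', None, []) # blank d) x) = col x"
      proof (rule fixed_absorbs)
        show "col (app (([Node a us], None, []) # d) x) = col x" by (simp add: d[symmetric] eq)
      qed (use \<open>g' \<preceq>\<^sub>p [Node a us]\<close> in simp)
      then show ?thesis using col_append[OF g'(2) refl, of x] by simp
    qed
    have y_absorb: "col (g @ ?y) = col ?y" if "g \<preceq>\<^sub>p t" for g
      using absorb[OF that] eq col_append[OF refl eq, of g] by simp
    have "col (app c ?y) = col ?y"
      by (rule col_antisym[of "[([], None, ?y)]"]) (use y_absorb[of t] in \<open>simp add: c[symmetric]\<close>)
    then have "col t = col ?y" by (simp only: c[symmetric])
    show ?thesis
    proof (rule fzeroI_left)
      fix g assume "g \<preceq>\<^sub>p t"
      then show "col (g @ t) = col t"
        using y_absorb[of g] col_append[OF refl \<open>col t = col ?y\<close>, of g] \<open>col t = col ?y\<close> by simp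
    qed
  qed
qed

text \<open>Follow the only child with all the types of \<open>t\<close> as long as there is exactly one.\<close>

lemma nonbranching_path:
  assumes N: "\<And>s. card (types s) \<le> k \<Longrightarrow> bound N s" and t: "card (types t) \<le> Suc k"
  shows "x \<in> subs t \<Longrightarrow> \<exists>w y. x = app w y \<and> y \<in> subs x \<and> sides_bounded (Suc N) w \<and>
    (bound (Suc N + N) y \<or>
     (\<exists>a us ts. y = Node a us # ts \<and> types us = types t \<and> types ts = types t))"
proof (induction x rule: subs.induct)
  case 1
  then show ?case by (auto simp: sides_bounded_def intro!: exI[of _ "[]"] alt_bound_mono[OF bound_Nil])
next
  case (2 a us ts)
  have sub: "us \<in> subs t" "ts \<in> subs t" using subs_trans[OF _ 2(3)] by auto
  have small: "bound N s" if "s \<in> subs t" "types s \<noteq> types t" for s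
    using N types_less[OF types_mono[OF subs_piece[OF that(1)]] that(2) t] by blast
  have nil: "bound n []" for n by (rule alt_bound_mono[OF bound_Nil]) simp
  consider "types us \<noteq> types t" "types ts \<noteq> types t" | "types us = types t" "types ts = types t"
    | "types us = types t" "types ts \<noteq> types t" | "types us \<noteq> types t" "types ts = types t" by blast
  then show ?case
  proof cases
    case 1
    then have "bound (Suc N + N) (Node a us # ts)"
      using small sub by (intro bound_Node) auto
    then show ?thesis by (intro exI[of _ "[]"] exI[of _ "Node a us # ts"]) (simp add: sides_bounded_def)
  next
    case 2
    then show ?thesis by (intro exI[of _ "[]"] exI[of _ "Node a us # ts"]) (simp add: sides_bounded_def)
  next
    case 3
    obtain w y where w: "us = app w y" "y \<in> subs us" "sides_bounded (Suc N) w"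
      "bound (Suc N + N) y \<or> (\<exists>a us ts. y = Node a us # ts \<and> types us = types t \<and> types ts = types t)"
      using 2(1)[OF sub(1)] by blast
    have "bound (Suc N) ts" using alt_bound_Suc[OF small[OF sub(2) 3(2)]] .
    then show ?thesis using w nil
      by (intro exI[of _ "([], Some a, ts) # w"] exI[of _ y]) (simp add: sides_bounded_Cons del: alt_bound.simps)
  next
    case 4
    obtain w y where w: "ts = app w y" "y \<in> subs ts" "sides_bounded (Suc N) w"
      "bound (Suc N + N) y \<or> (\<exists>a us ts. y = Node a us # ts \<and> types us = types t \<and> types ts = types t)"
      using 2(2)[OF sub(2)] by blast
    \<comment> \<open>A passed tree has a root above \<open>us\<close>; this is why side forests are
      bounded by \<open>Suc N\<close> and not by \<open>N\<close>.\<close>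
    have "bound (Suc N) [Node a us]" using bound_Node[OF small[OF sub(1) 4(1)] bound_Nil] by simp
    then show ?thesis using w nil
      by (intro exI[of _ "([Node a us], None, []) # w"] exI[of _ y])
        (simp add: sides_bounded_Cons del: alt_bound.simps)
  qed
qed

lemma finite_subs [simp]: "finite (subs t)"
  by (induction t rule: subs.induct) auto

text \<open>Induction on the number of colours of subterms of \<open>x\<close>. The path to the
  first branching node costs a uniform \<open>W\<close>; by \<open>fzero_branch\<close> the colour
  of that node does not recur below it, so each child has fewer colours.\<close>

lemma nonzero_bound:
  assumes N: "\<And>s. card (types s) \<le> k \<Longrightarrow> bound N s"
  shows "\<exists>B. \<forall>t x. card (types t) \<le> Suc k \<longrightarrow> \<not> fzero t \<longrightarrow> x \<in> subs t \<longrightarrow>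
    card (col ` subs x) \<le> i \<longrightarrow> bound B x"
proof (induction i)
  case 0
  have "card (col ` subs x) \<noteq> 0" for x using subs_refl[of x] by (auto simp: card_eq_0_iff simp del: subs_refl)
  then show ?case by auto
next
  case (Suc i)
  then obtain B where B: "\<And>t x. card (types t) \<le> Suc k \<Longrightarrow> \<not> fzero t \<Longrightarrow> x \<in> subs t \<Longrightarrow>
    card (col ` subs x) \<le> i \<Longrightarrow> bound B x" by blast
  obtain W where W: "\<And>w. sides_bounded (Suc N) w \<Longrightarrow> wbound W w" using wbound_exists by blast
  \<comment> \<open>\<open>Suc N + N\<close> covers a path that ends without branching,
    \<open>Suc B + B\<close> a branching node with its two children.\<close>
  let ?D = "Suc N + N + (Suc B + B)"
  have "bound (W + ?D) x" if t: "card (types t) \<le> Suc k" "\<not> fzero t" and x: "x \<in> subs t"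
    "card (col ` subs x) \<le> Suc i" for t x
  proof -
    from nonbranching_path[OF N t(1) x(1)] obtain w y where w: "x = app w y" "y \<in> subs x"
      "sides_bounded (Suc N) w" and y: "bound (Suc N + N) y \<or>
        (\<exists>a us ts. y = Node a us # ts \<and> types us = types t \<and> types ts = types t)" by blast
    from y have "bound ?D y"
    proof
      assume "\<exists>a us ts. y = Node a us # ts \<and> types us = types t \<and> types ts = types t"
      then obtain a us ts where y: "y = Node a us # ts" "types us = types t" "types ts = types t"
        by blast
      have yt: "y \<in> subs t" using subs_trans[OF w(2) x(1)] .
      have "bound B z" if z: "z = us \<or> z = ts" for z
      proof (rule B[OF t])
        show "z \<in> subs t" using subs_trans[OF _ yt] y(1) z by auto
        have "subs z \<subseteq> subs y" "subs y \<subseteq> subs x" using z y(1) subs_trans[OF _ w(2)] by auto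
        moreover have "col y \<notin> col ` subs z"
          using fzero_branch[of a us ts t] yt y z t(2) by force
        moreover have "col y \<in> col ` subs x" using w(2) by blast
        ultimately have "col ` subs z \<subset> col ` subs x" by blast
        then have "card (col ` subs z) < card (col ` subs x)" by (intro psubset_card_mono) auto
        then show "card (col ` subs z) \<le> i" using x(2) by simp
      qed
      then have "bound (Suc B + B) y" unfolding y(1) by (intro bound_Node) auto
      then show ?thesis by (rule alt_bound_mono) simp
    qed (erule alt_bound_mono, simp)
    then show ?thesis unfolding w(1) by (rule bound_app[OF W[OF w(3)]])
  qed
  then show ?case by blast
qed

text \<open>As for words: once the colour of an absorbing forest is left, the pieces have fewer
  types or are not absorbing.\<close>

lemma bound_exists_card: "\<exists>N. \<forall>t. card (types t) \<le> k \<longrightarrow> bound N t"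
proof (induction k)
  case 0
  have "card (types t) \<noteq> 0" for t
    using types_self[of t] finite_types[of t] by (metis card_eq_0_iff empty_iff)
  then show ?case by auto
next
  case (Suc k)
  then obtain N where N: "\<And>t. card (types t) \<le> k \<Longrightarrow> bound N t" by blast
  from nonzero_bound[OF N, where i = "card (range col)"]
  obtain B where B: "\<And>t x. card (types t) \<le> Suc k \<Longrightarrow> \<not> fzero t \<Longrightarrow> x \<in> subs t \<Longrightarrow>
    card (col ` subs x) \<le> card (range col) \<Longrightarrow> bound B x" by blast
  have nz: "bound B t" if "card (types t) \<le> Suc k" "\<not> fzero t" for t
    using that B[of t t] card_mono[OF finite_range, of "col ` subs t"] by (simp add: image_mono)
  have "bound (Suc (B + N)) t" if t: "card (types t) \<le> Suc k" for t
  proof (cases "fzero t")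
    case False
    then show ?thesis using nz[OF t] by (auto intro: alt_bound_mono simp del: alt_bound.simps)
  next
    case True
    have "bound (B + N) s" if s: "s \<preceq>\<^sub>p t" "col s \<noteq> col t" for s
    proof (cases "types s = types t")
      case True
      then have "\<not> fzero s" using fzero_unique[of s t] \<open>fzero t\<close> s(2) by blast
      then have "bound B s" using nz t True by simp
      then show ?thesis by (rule alt_bound_mono) simp
    next
      case False
      then have "bound N s" using N t types_mono[OF s(1)] types_less by blast
      then show ?thesis by (rule alt_bound_mono) simp
    qed
    then show ?thesis by simp
  qed
  then show ?case by blast
qed

lemma bound_exists: "\<exists>N. \<forall>t. bound N t"
proof -
  have "card (types t) \<le> card (range col)" for t
    by (rule card_mono[OF finite_range]) (auto simp: types_def)
  then show ?thesis using bound_exists_card[of "card (range col)"] by blast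
qed

section \<open>Intermediate pieces of bounded size\<close>

definition small_between :: "nat \<Rightarrow> 'a forest \<Rightarrow> 'a forest \<Rightarrow> bool" where
  "small_between K s t \<longleftrightarrow> (\<exists>t'. s \<preceq>\<^sub>p t' \<and> t' \<preceq>\<^sub>p t \<and> col t' = col t \<and> num_nodes t' \<le> K)"

lemma small_between_mono: "small_between J s t \<Longrightarrow> J \<le> K \<Longrightarrow> small_between K s t"
  unfolding small_between_def using le_trans by blast

lemma num_nodes_subs: "s \<in> subs t \<Longrightarrow> num_nodes s \<le> num_nodes t"
  by (induction t rule: subs.induct) auto

text \<open>Pass to a smallest subterm \<open>x\<close> that has the colour of \<open>t\<close> and
  contains \<open>s\<close>, and distribute \<open>s\<close> over the children of \<open>x\<close>.
  A part smaller than \<open>s\<close> is handled by \<open>K\<close>. If all of \<open>s\<close>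
  goes to one child, minimality removes the colour of \<open>t\<close> from the subterms of that
  child containing \<open>s\<close>, and \<open>J\<close> applies.\<close>

lemma small_between_card:
  assumes K: "\<And>s t. s \<preceq>\<^sub>p t \<Longrightarrow> num_nodes s < m \<Longrightarrow> small_between K s t"
  shows "\<exists>K. \<forall>s t. s \<preceq>\<^sub>p t \<longrightarrow> num_nodes s \<le> m \<longrightarrow>
    card (col ` {x \<in> subs t. s \<preceq>\<^sub>p x}) \<le> j \<longrightarrow> small_between K s t"
proof (induction j)
  case 0
  have "\<not> card (col ` {x \<in> subs t. s \<preceq>\<^sub>p x}) \<le> 0" if "s \<preceq>\<^sub>p t" for s t
    using that subs_refl[of t] by (auto simp: card_eq_0_iff simp del: subs_refl)
  then show ?case by blast
next
  case (Suc j)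
  then obtain J where J: "\<And>s t. s \<preceq>\<^sub>p t \<Longrightarrow> num_nodes s \<le> m \<Longrightarrow>
    card (col ` {x \<in> subs t. s \<preceq>\<^sub>p x}) \<le> j \<Longrightarrow> small_between J s t" by blast
  \<comment> \<open>One node for the root of \<open>x\<close>, and \<open>K + J\<close> for each of
    its two children, whichever case occurs there.\<close>
  have "small_between (Suc ((K + J) + (K + J))) s t"
    if st: "s \<preceq>\<^sub>p t" "num_nodes s \<le> m" "card (col ` {x \<in> subs t. s \<preceq>\<^sub>p x}) \<le> Suc j" for s t
  proof -
    let ?P = "\<lambda>x. x \<in> subs t \<and> s \<preceq>\<^sub>p x \<and> col x = col t"
    have "?P t" using st by simp
    from ex_has_least_nat[of ?P, OF this, of num_nodes] obtain x where x: "?P x"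
      and least: "\<And>y. ?P y \<Longrightarrow> num_nodes x \<le> num_nodes y" by blast
    show ?thesis
    proof (cases x rule: subs.cases)
      case 1
      then show ?thesis using x unfolding small_between_def by (intro exI[of _ "[]"]) auto
    next
      case (2 a us ts)
      then obtain us' ts' where pieces: "us' \<preceq>\<^sub>p us" "ts' \<preceq>\<^sub>p ts"
        and s: "s = Node a us' # ts' \<or> s = us' @ ts'" using x by (auto simp: piece_Cons)
      have small: "small_between (K + J) r z"
        if z: "z = us \<or> z = ts" and r: "r \<preceq>\<^sub>p z" "r = s \<or> num_nodes r < num_nodes s" for r z
        using r(2)
      proof
        assume "num_nodes r < num_nodes s"
        then have "small_between K r z" using K[OF r(1)] st(2) by simp
        then show ?thesis by (rule small_between_mono) simp
      next
        assume rs: "r = s"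
        have sub: "subs z \<subseteq> subs t" using z 2 x subs_trans[of _ x t] by auto
        have "num_nodes y < num_nodes x" if "y \<in> subs z" for y
          using num_nodes_subs[OF that] z 2 by auto
        then have "col y \<noteq> col t" if "y \<in> subs z" "s \<preceq>\<^sub>p y" for y
          using least[of y] sub that by (meson not_le subsetD)
        then have "col t \<notin> col ` {y \<in> subs z. s \<preceq>\<^sub>p y}" by force
        moreover have "col t \<in> col ` {y \<in> subs t. s \<preceq>\<^sub>p y}" using st(1) by auto
        moreover have "col ` {y \<in> subs z. s \<preceq>\<^sub>p y} \<subseteq> col ` {y \<in> subs t. s \<preceq>\<^sub>p y}"
          using sub by blast
        ultimately have "col ` {y \<in> subs z. s \<preceq>\<^sub>p y} \<subset> col ` {y \<in> subs t. s \<preceq>\<^sub>p y}" by blast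
        then have "card (col ` {y \<in> subs z. s \<preceq>\<^sub>p y}) < card (col ` {y \<in> subs t. s \<preceq>\<^sub>p y})"
          by (intro psubset_card_mono) auto
        then have "small_between J s z" using J[of s z] r(1) rs st by simp
        then show ?thesis unfolding rs by (rule small_between_mono) simp
      qed
      \<comment> \<open>A part other than \<open>s\<close> itself has lost the root or a nonempty
        sibling part.\<close>
      have "us' = s \<or> num_nodes us' < num_nodes s" "ts' = s \<or> num_nodes ts' < num_nodes s"
        using s by (elim disjE; cases "us' = []"; cases "ts' = []"; simp add: labels_eq_Nil)+
      then have "small_between (K + J) us' us" "small_between (K + J) ts' ts"
        using small pieces by blast+
      then obtain us'' ts'' where
        us'': "us' \<preceq>\<^sub>p us''" "us'' \<preceq>\<^sub>p us" "col us'' = col us" "num_nodes us'' \<le> K + J" and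
        ts'': "ts' \<preceq>\<^sub>p ts''" "ts'' \<preceq>\<^sub>p ts" "col ts'' = col ts" "num_nodes ts'' \<le> K + J"
        unfolding small_between_def by blast
      show ?thesis
        unfolding small_between_def
      proof (intro exI conjI)
        show "s \<preceq>\<^sub>p Node a us'' # ts''"
          using s piece_keep[OF us''(1) ts''(1)] piece_skip[OF us''(1) ts''(1)] by blast
        have "Node a us'' # ts'' \<preceq>\<^sub>p x" unfolding 2 by (rule piece_keep[OF us''(2) ts''(2)])
        moreover have "x \<preceq>\<^sub>p t" using x by (simp add: subs_piece)
        ultimately show "Node a us'' # ts'' \<preceq>\<^sub>p t" by (rule piece_trans)
        show "col (Node a us'' # ts'') = col t"
          using x 2 col_Node[OF us''(3) ts''(3), of a] by simp
        show "num_nodes (Node a us'' # ts'') \<le> Suc ((K + J) + (K + J))" using us'' ts'' by simp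
      qed
    qed
  qed
  then show ?case by blast
qed

lemma small_between_exists:
  "\<exists>K. \<forall>s t. s \<preceq>\<^sub>p t \<longrightarrow> num_nodes s \<le> m \<longrightarrow> small_between K s t"
proof (induction m rule: less_induct)
  case (less m)
  have "\<exists>K. \<forall>s t. s \<preceq>\<^sub>p t \<longrightarrow> num_nodes s < m \<longrightarrow> small_between K s t"
  proof (cases m)
    case (Suc m')
    then show ?thesis using less[of m'] by (simp add: less_Suc_eq_le)
  qed simp
  then obtain K where K: "\<And>s t. s \<preceq>\<^sub>p t \<Longrightarrow> num_nodes s < m \<Longrightarrow> small_between K s t" by blast
  have "card (col ` {x \<in> subs t. s \<preceq>\<^sub>p x}) \<le> card (range col)" for s t
    by (rule card_mono[OF finite_range]) blast
  moreover obtain K' where "\<And>s t. s \<preceq>\<^sub>p t \<Longrightarrow> num_nodes s \<le> m \<Longrightarrow>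
    card (col ` {x \<in> subs t. s \<preceq>\<^sub>p x}) \<le> card (range col) \<Longrightarrow> small_between K' s t"
    using small_between_card[OF K, where j = "card (range col)"] by blast
  ultimately show ?case by blast
qed

text \<open>A small piece of one forest is a piece of the other, where it extends to a bounded piece
  of the other colour. Going back and forth gives a chain of alternating colours, too long for the
  bound \<open>N\<close>.\<close>

theorem colour_determined_by_pieces:
  "\<exists>n. \<forall>s t. {r. r \<preceq>\<^sub>p s \<and> num_nodes r \<le> n} = {r. r \<preceq>\<^sub>p t \<and> num_nodes r \<le> n} \<longrightarrow> col s = col t"
proof -
  obtain N where N: "\<And>t. bound N t" using bound_exists by blast
  have "\<forall>m. \<exists>K. \<forall>s t. s \<preceq>\<^sub>p t \<longrightarrow> num_nodes s \<le> m \<longrightarrow> small_between K s t"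
    using small_between_exists by blast
  then obtain K where K: "\<And>m s t. s \<preceq>\<^sub>p t \<Longrightarrow> num_nodes s \<le> m \<Longrightarrow> small_between (K m) s t"
    by metis
  \<comment> \<open>The i-th piece of the chain has at most \<open>(K ^^ i) (K 0)\<close> nodes; the
    sum dominates all sizes up to \<open>N\<close>, so these pieces can be moved between
    \<open>s\<close> and \<open>t\<close>.\<close>
  define n where "n = (\<Sum>i \<le> N. (K ^^ i) (K 0))"
  have False
    if eq: "{r. r \<preceq>\<^sub>p s \<and> num_nodes r \<le> n} = {r. r \<preceq>\<^sub>p t \<and> num_nodes r \<le> n}" "col s \<noteq> col t" for s t
  proof -
    have same: "r \<preceq>\<^sub>p s \<longleftrightarrow> r \<preceq>\<^sub>p t" if "num_nodes r \<le> n" for r using eq(1) that by blast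
    \<comment> \<open>\<open>r\<close> is the i-th piece of the chain. That \<open>bound j\<close>
      fails for the predecessor \<open>j\<close> of \<open>i\<close> records the changes below
      \<open>r\<close>; for \<open>i = 0\<close> there is nothing to record.\<close>
    have "\<exists>r. r \<preceq>\<^sub>p x \<and> col r = col x \<and> num_nodes r \<le> (K ^^ i) (K 0) \<and> (\<forall>j. i = Suc j \<longrightarrow> \<not> bound j r)"
      if "i \<le> Suc N" "x = s \<or> x = t" for i x
      using that
    proof (induction i arbitrary: x)
      case 0
      then show ?case using K[of "[]" x 0] by (auto simp: small_between_def)
    next
      case (Suc i)
      define y where "y = (if x = s then t else s)"
      have y: "y = s \<or> y = t" "col y \<noteq> col x" using Suc.prems(2) eq(2) by (auto simp: y_def)
      have "i \<le> Suc N" using Suc.prems(1) by simp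
      from Suc.IH[OF this y(1)] obtain r where r: "r \<preceq>\<^sub>p y" "col r = col y"
        "num_nodes r \<le> (K ^^ i) (K 0)" "\<forall>j. i = Suc j \<longrightarrow> \<not> bound j r" by blast
      have "(K ^^ i) (K 0) \<le> n" unfolding n_def
        using Suc.prems(1) by (intro member_le_sum[of i "{..N}" "\<lambda>i. (K ^^ i) (K 0)"]) auto
      then have "r \<preceq>\<^sub>p x" using same[of r] r y(1) Suc.prems(2) by auto
      from K[OF this r(3)] obtain r' where r': "r \<preceq>\<^sub>p r'" "r' \<preceq>\<^sub>p x" "col r' = col x"
        "num_nodes r' \<le> K ((K ^^ i) (K 0))" unfolding small_between_def by blast
      have differ: "col r \<noteq> col r'" using r(2) r'(3) y(2) by simp
      have "\<not> bound i r'"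
      proof (cases i)
        case 0
        then show ?thesis using r'(1) differ by auto
      next
        case (Suc j)
        then show ?thesis using r'(1) differ r(4) by auto
      qed
      then show ?case using r' by auto
    qed
    from this[of "Suc N" s] show False using N by blast
  qed
  then show ?thesis by blast
qed

end

section \<open>Contexts as words\<close>

lemma piece_map: "s \<preceq>\<^sub>p t \<Longrightarrow> map (map_tree h) s \<preceq>\<^sub>p map (map_tree h) t"
  unfolding piece_emb by (induction rule: emb.induct) (auto intro: emb.intros)

lemma piece_num_nodes: "s \<preceq>\<^sub>p t \<Longrightarrow> num_nodes s \<le> num_nodes t"
  unfolding piece_emb by (induction rule: emb.induct) auto

lemma piece_num_nodes_eq: "s \<preceq>\<^sub>p t \<Longrightarrow> num_nodes s = num_nodes t \<Longrightarrow> s = t"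
  unfolding piece_emb
proof (induction rule: emb.induct)
  case (keep s t s' t' a)
  then show ?case
    using piece_num_nodes[unfolded piece_emb, OF keep(1)] piece_num_nodes[unfolded piece_emb, OF keep(2)]
    by simp
next
  case (skip s t s' t' a)
  then show ?case
    using piece_num_nodes[unfolded piece_emb, OF skip(1)] piece_num_nodes[unfolded piece_emb, OF skip(2)]
    by simp
qed simp

lemma plug_mono: "p \<preceq>\<^sub>p q \<Longrightarrow> holes_are_leaves q \<Longrightarrow> plug p s \<preceq>\<^sub>p plug q s"
  unfolding piece_emb[of p q]
proof (induction rule: emb.induct)
  case (keep p q p' q' x)
  then show ?case by (cases x) (auto intro: piece_append piece_keep)
next
  case (skip p q p' q' x)
  show ?case
  proof (cases x)
    case None
    \<comment> \<open>A hole is a leaf, so deleting it leaves nothing in its place.\<close>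
    then have "p = []" using skip by (simp add: emb_Nil_right)
    then show ?thesis using None skip piece_append[of "[]" s "plug p' s"] by simp
  next
    case (Some a)
    then show ?thesis using skip by (auto intro: piece_skip)
  qed
qed simp

lemma small_piece_pow:
  "x \<preceq>\<^sub>p app (word_pow (Suc k) w) s \<Longrightarrow> num_nodes x \<le> k \<Longrightarrow> x \<preceq>\<^sub>p app (word_pow k w) s"
proof (induction k arbitrary: x)
  case (0 x)
  then show ?case by (simp add: labels_eq_Nil)
next
  case (Suc k x)
  have "x \<preceq>\<^sub>p app w (app (word_pow (Suc k) w) s)" using Suc.prems(1) by simp
  then obtain v r where v: "word_le v w" and r: "r \<preceq>\<^sub>p app (word_pow (Suc k) w) s"
    and x: "x = app v r" by (rule piece_appE)
  have rx: "r \<preceq>\<^sub>p x" unfolding x by (rule piece_app)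
  show ?case
  proof (cases "num_nodes r = num_nodes x")
    case True
    then show ?thesis using piece_num_nodes_eq[OF rx] r by simp
  next
    case False
    then have "num_nodes r \<le> k" using piece_num_nodes[OF rx] Suc.prems(2) by simp
    from app_mono[OF v Suc.IH[OF r this]] show ?thesis unfolding x by simp
  qed
qed

lemma small_piece_app_pow:
  assumes x: "x \<preceq>\<^sub>p app z (app (word_pow (Suc k) w) s)" and "num_nodes x \<le> k"
  shows "x \<preceq>\<^sub>p app z (app (word_pow k w) s)"
proof -
  from x obtain v r where v: "word_le v z" and r: "r \<preceq>\<^sub>p app (word_pow (Suc k) w) s"
    and xv: "x = app v r" by (rule piece_appE)
  have "num_nodes r \<le> num_nodes x" unfolding xv by (rule piece_num_nodes[OF piece_app])
  then have "r \<preceq>\<^sub>p app (word_pow k w) s" using small_piece_pow[OF r] assms(2) by simp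
  then show ?thesis unfolding xv by (rule app_mono[OF v])
qed

fun ctx :: "'a letter list \<Rightarrow> 'a ctxt" where
  "ctx [] = hole"
| "ctx ((f, None, g) # w) = embed f @ ctx w @ embed g"
| "ctx ((f, Some a, g) # w) = embed f @ Node (Some a) (ctx w) # embed g"

definition words :: "'a set \<Rightarrow> 'a letter list set" where
  "words A = {w. \<forall>(f, x, g) \<in> set w. f \<in> forests A \<and> g \<in> forests A \<and> (\<forall>a. x = Some a \<longrightarrow> a \<in> A)}"

lemma words_Nil [simp]: "[] \<in> words A"
  by (simp add: words_def)

lemma words_Cons: "(f, x, g) # w \<in> words A \<longleftrightarrow>
  f \<in> forests A \<and> g \<in> forests A \<and> (\<forall>a. x = Some a \<longrightarrow> a \<in> A) \<and> w \<in> words A"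
  by (auto simp: words_def)

lemma words_append: "u @ v \<in> words A \<longleftrightarrow> u \<in> words A \<and> v \<in> words A"
  by (simp add: words_def ball_Un)

lemma words_pow: "w \<in> words A \<Longrightarrow> word_pow k w \<in> words A"
  by (induction k) (simp_all add: words_append)

lemma plug_ctx: "plug (ctx w) s = app w s"
  by (induction w rule: ctx.induct) simp_all

lemma comp_ctxt_embed [simp]: "comp_ctxt (embed f) q = embed f"
  by (induction f rule: labels.induct) (auto simp: embed_def)

lemma ctx_append: "ctx (u @ v) = comp_ctxt (ctx u) (ctx v)"
  by (induction u rule: ctx.induct) (simp_all add: comp_ctxt_append)

lemma ctx_in_contexts: "w \<in> words A \<Longrightarrow> ctx w \<in> contexts A"
proof (induction w rule: ctx.induct)
  case (2 f g w)
  then show ?case by (auto simp: words_Cons contexts_def forests_def)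
next
  case (3 f a g w)
  then show ?case by (auto simp: words_Cons contexts_def forests_def)
qed simp

lemma no_hole_embed:
  "count_list (labels p) None = 0 \<Longrightarrow> set (labels p) \<subseteq> insert None (Some ` A) \<Longrightarrow>
    \<exists>s \<in> forests A. p = embed s"
proof (induction p rule: labels.induct)
  case 1
  then show ?case by (intro bexI[of _ "[]"]) (auto simp: embed_def)
next
  case (2 x us ts)
  then obtain a where a: "x = Some a" "a \<in> A" by (cases x) auto
  obtain f g where "f \<in> forests A" "us = embed f" "g \<in> forests A" "ts = embed g"
    using 2 a by (auto split: if_splits)
  then show ?case using a by (intro bexI[of _ "Node a f # g"]) (auto simp: embed_def forests_def)
qed

text \<open>Follow the path to the hole: a tree without the hole is passed as a left summand, a tree
  with the hole is entered through its root.\<close>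

lemma contexts_ctx: "p \<in> contexts A \<Longrightarrow> \<exists>w \<in> words A. p = ctx w"
proof (induction p rule: labels.induct)
  case 1
  then show ?case by (simp add: contexts_def)
next
  case (2 x us ts)
  have labels: "set (labels us) \<subseteq> insert None (Some ` A)" "set (labels ts) \<subseteq> insert None (Some ` A)"
    and leaves: "holes_are_leaves us" "holes_are_leaves ts"
    using 2(3) by (auto simp: contexts_def forests_def)
  show ?case
  proof (cases x)
    case None
    then have "us = []" "count_list (labels ts) None = 0" using 2(3) by (auto simp: contexts_def)
    then obtain g where "g \<in> forests A" "ts = embed g" using no_hole_embed labels by blast
    then show ?thesis using None \<open>us = []\<close>
      by (intro bexI[of _ "[([], None, g)]"]) (auto simp: words_Cons hole_def embed_def)
  next
    case (Some a)
    have a: "a \<in> A" using 2(3) Some by (auto simp: contexts_def forests_def)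
    have count: "count_list (labels us) None + count_list (labels ts) None = 1"
      using 2(3) Some by (simp add: contexts_def)
    show ?thesis
    proof (cases "count_list (labels us) None = 0")
      case True
      then obtain f where f: "f \<in> forests A" "us = embed f" using no_hole_embed labels by blast
      have "ts \<in> contexts A" using True count labels leaves by (simp add: contexts_def forests_def)
      then obtain w where "w \<in> words A" "ts = ctx w" using 2(2) by blast
      then show ?thesis using f a Some
        by (intro bexI[of _ "([Node a f], None, []) # w"])
          (auto simp: words_Cons embed_def forests_def)
    next
      case False
      then have "count_list (labels ts) None = 0" using count by simp
      then obtain g where g: "g \<in> forests A" "ts = embed g" using no_hole_embed labels by blast
      have "us \<in> contexts A" using False count labels leaves by (simp add: contexts_def forests_def)
      then obtain w where "w \<in> words A" "us = ctx w" using 2(1) by blast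
      then show ?thesis using g a Some
        by (intro bexI[of _ "([], Some a, g) # w"]) (auto simp: words_Cons embed_def)
    qed
  qed
qed

lemma piece_embed: "s \<preceq>\<^sub>p t \<Longrightarrow> embed s \<preceq>\<^sub>p embed t"
  unfolding embed_def by (rule piece_map)

lemma ctx_mono: "word_le v w \<Longrightarrow> ctx v \<preceq>\<^sub>p ctx w"
proof (induction rule: list_all2_induct)
  case (Cons x v y w)
  obtain f a g f' b g' where xy: "x = (f, a, g)" "y = (f', b, g')" by (cases x; cases y)
  then have le: "embed f \<preceq>\<^sub>p embed f'" "embed g \<preceq>\<^sub>p embed g'" "a = None \<or> a = b"
    using Cons(1) piece_embed by auto
  show ?case
  proof (cases a)
    case None
    have "embed f @ ctx v @ embed g \<preceq>\<^sub>p embed f' @ ctx w @ embed g'"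
      using le Cons.IH by (intro piece_append)
    moreover have "embed f @ ctx v @ embed g \<preceq>\<^sub>p embed f' @ Node c (ctx w) # embed g'" for c
      using le Cons.IH by (intro piece_append piece_skip)
    ultimately show ?thesis using None xy by (cases b) auto
  next
    case (Some c)
    have "embed f @ Node (Some c) (ctx v) # embed g \<preceq>\<^sub>p embed f' @ Node (Some c) (ctx w) # embed g'"
      using le Cons.IH by (intro piece_append piece_keep)
    then show ?thesis using Some xy le by auto
  qed
qed simp

text \<open>Deleting the nodes outside \<open>A\<close> extends functions on \<^term>\<open>forests A\<close> to all forests.\<close>

fun restrict_labels :: "'a set \<Rightarrow> 'a forest \<Rightarrow> 'a forest" where
  "restrict_labels A [] = []"
| "restrict_labels A (Node a us # ts) =
    (if a \<in> A then [Node a (restrict_labels A us)] else restrict_labels A us) @ restrict_labels A ts"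

fun restrict_letter :: "'a set \<Rightarrow> 'a letter \<Rightarrow> 'a letter" where
  "restrict_letter A (f, x, g) =
    (restrict_labels A f, if x \<in> Some ` A then x else None, restrict_labels A g)"

lemma restrict_labels_append [simp]:
  "restrict_labels A (s @ t) = restrict_labels A s @ restrict_labels A t"
  by (induction A s rule: restrict_labels.induct) auto

lemma restrict_labels_in_forests [simp]: "restrict_labels A s \<in> forests A"
  by (induction A s rule: restrict_labels.induct) (auto simp: forests_def)

lemma restrict_labels_id: "s \<in> forests A \<Longrightarrow> restrict_labels A s = s"
  by (induction A s rule: restrict_labels.induct) (auto simp: forests_def)

lemma restrict_labels_mono: "s \<preceq>\<^sub>p t \<Longrightarrow> restrict_labels A s \<preceq>\<^sub>p restrict_labels A t"
  unfolding piece_emb[of s t]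
  by (induction rule: emb.induct) (auto intro: piece_keep piece_skip piece_append)

lemma restrict_labels_app:
  "restrict_labels A (app w s) = app (map (restrict_letter A) w) (restrict_labels A s)"
proof (induction w)
  case (Cons x w)
  obtain f y g where "x = (f, y, g)" by (cases x)
  then show ?case using Cons by (cases y) auto
qed simp

lemma restrict_letter_words: "map (restrict_letter A) w \<in> words A"
  by (induction w) (auto simp: words_def split: if_splits)

lemma restrict_letter_mono: "word_le v w \<Longrightarrow> word_le (map (restrict_letter A) v) (map (restrict_letter A) w)"
  by (induction rule: list_all2_induct) (auto intro: restrict_labels_mono)

lemma map_word_pow: "map h (word_pow k w) = word_pow k (map h w)"
  by (simp add: map_concat)

section \<open>Pieces in the syntactic algebra\<close>

lemma free_forest_alg_simps [simp]:
  "carrier (Hor (free_forest_alg A)) = forests A"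
  "carrier (Ver (free_forest_alg A)) = contexts A"
  "s \<otimes>\<^bsub>Hor (free_forest_alg A)\<^esub> t = s @ t"
  "p \<otimes>\<^bsub>Ver (free_forest_alg A)\<^esub> q = comp_ctxt p q"
  "\<one>\<^bsub>Hor (free_forest_alg A)\<^esub> = []"
  "\<one>\<^bsub>Ver (free_forest_alg A)\<^esub> = hole"
  "act (free_forest_alg A) = plug"
  "add_left (free_forest_alg A) s = embed s @ hole"
  "add_right (free_forest_alg A) s = hole @ embed s"
  by (simp_all add: free_forest_alg_def)

lemma forest_alg_morphism_compose:
  assumes "forest_alg_morphism E F \<alpha> \<beta>" "forest_alg_morphism F G \<gamma> \<delta>"
  shows "forest_alg_morphism E G (\<gamma> \<circ> \<alpha>) (\<delta> \<circ> \<beta>)"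
  using assms by (auto simp: forest_alg_morphism_def hom_def Pi_iff)

section \<open>Renaming of letters\<close>

abbreviation rename :: "('a \<Rightarrow> 'b) \<Rightarrow> 'a forest \<Rightarrow> 'b forest" where
  "rename d \<equiv> map (map_tree d)"

lemma labels_rename: "labels (rename d t) = map d (labels t)"
  by (induction t rule: labels.induct) auto

lemma rename_rename: "rename d (rename e t) = rename (d \<circ> e) t"
  by (induction t rule: labels.induct) auto

lemma rename_id: "(\<And>x. x \<in> set (labels t) \<Longrightarrow> d x = x) \<Longrightarrow> rename d t = t"
  by (induction t rule: labels.induct) auto

lemma rename_embed: "rename (map_option d) (embed s) = embed (rename d s)"
  by (induction s rule: labels.induct) (auto simp: embed_def)

lemma rename_hole: "rename (map_option d) hole = hole"
  by (simp add: hole_def)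

lemma rename_plug: "rename d (plug p s) = plug (rename (map_option d) p) (rename d s)"
  by (induction p s rule: plug.induct) auto

lemma rename_comp_ctxt:
  "rename (map_option d) (comp_ctxt p q) = comp_ctxt (rename (map_option d) p) (rename (map_option d) q)"
  by (induction p q rule: comp_ctxt.induct) auto

lemma holes_are_leaves_rename:
  "holes_are_leaves (rename (map_option d) p) \<longleftrightarrow> holes_are_leaves p"
  by (induction p rule: holes_are_leaves.induct) auto

lemma count_list_map_option: "count_list (map (map_option d) xs) None = count_list xs None"
  by (induction xs) auto

lemma rename_in_forests: "d ` B \<subseteq> A \<Longrightarrow> s \<in> forests B \<Longrightarrow> rename d s \<in> forests A"
  by (auto simp: forests_def labels_rename)

lemma rename_in_contexts:
  assumes d: "d ` B \<subseteq> A" and p: "p \<in> contexts B"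
  shows "rename (map_option d) p \<in> contexts A"
proof -
  have "map_option d x \<in> insert None (Some ` A)" if "x \<in> set (labels p)" for x
  proof (cases x)
    case (Some b)
    then have "b \<in> B" using p that by (auto simp: contexts_def forests_def)
    then show ?thesis using Some d by auto
  qed simp
  then have "rename (map_option d) p \<in> forests (insert None (Some ` A))"
    unfolding forests_def mem_Collect_eq labels_rename set_map by (rule image_subsetI)
  then show ?thesis
    using p by (simp add: contexts_def labels_rename count_list_map_option holes_are_leaves_rename)
qed

lemma rename_morphism:
  "d ` B \<subseteq> A \<Longrightarrow>
    forest_alg_morphism (free_forest_alg B) (free_forest_alg A) (rename d) (rename (map_option d))"
  by (simp add: forest_alg_morphism_def hom_def rename_in_forests rename_in_contexts rename_plug
      rename_comp_ctxt rename_hole rename_embed)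

text \<open>The alphabets in \<open>ver_piece\<close> consist of natural numbers, so letters are
  coded by an injection \<open>e\<close>; decoding followed by the quotient map is the required
  morphism.\<close>

lemma ver_pieceI:
  assumes "finite A" and p: "p \<in> contexts A" and q: "q \<in> contexts A" and "p \<preceq>\<^sub>p q"
  shows "ver_piece (syntactic_alg A L) (syn_rel_ctxt A L `` {p}) (syn_rel_ctxt A L `` {q})"
proof -
  obtain e :: "'a \<Rightarrow> nat" where e: "inj_on e A"
    using finite_imp_inj_to_nat_seg[OF assms(1)] by blast
  let ?B = "e ` A" and ?d = "map_option (inv_into A e)" and ?e = "map_option e"
  have d: "inv_into A e ` ?B \<subseteq> A" by (auto intro: inv_into_into)
  have inv: "rename ?d (rename ?e r) = r" if "r \<in> contexts A" for r
    unfolding rename_rename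
  proof (rule rename_id)
    fix x assume "x \<in> set (labels r)"
    then have "x \<in> insert None (Some ` A)" using that by (auto simp: contexts_def forests_def)
    then show "(?d \<circ> ?e) x = x" using e by auto
  qed
  have "rename ?e p \<in> contexts ?B" "rename ?e q \<in> contexts ?B"
    using p q by (auto intro: rename_in_contexts)
  moreover have "rename ?e p \<preceq>\<^sub>p rename ?e q" by (rule piece_map) fact
  moreover have "forest_alg_morphism (free_forest_alg ?B) (syntactic_alg A L)
      ((\<lambda>s. syn_rel A L `` {s}) \<circ> rename (inv_into A e))
      ((\<lambda>p. syn_rel_ctxt A L `` {p}) \<circ> rename ?d)"
    by (rule forest_alg_morphism_compose[OF rename_morphism[OF d] syntactic_morphism])
  moreover have "((\<lambda>p. syn_rel_ctxt A L `` {p}) \<circ> rename ?d) (rename ?e r) = syn_rel_ctxt A L `` {r}"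
    if "r \<in> contexts A" for r
    using inv[OF that] by simp
  moreover have "finite ?B" using assms(1) by simp
  ultimately show ?thesis unfolding ver_piece_def using p q by blast
qed

text \<open>A morphism from a free forest algebra to the syntactic algebra lifts to a substitution of contexts
  for letters. Substitution preserves pieces because a context contains its hole.\<close>

fun subst :: "('b \<Rightarrow> 'a ctxt) \<Rightarrow> 'b ctxt \<Rightarrow> 'a ctxt" where
  "subst c [] = []"
| "subst c (Node None us # ts) = Node None [] # subst c ts"
| "subst c (Node (Some b) us # ts) = comp_ctxt (c b) (subst c us) @ subst c ts"

fun subst_forest :: "('b \<Rightarrow> 'a ctxt) \<Rightarrow> 'b forest \<Rightarrow> 'a forest" where
  "subst_forest c [] = []"
| "subst_forest c (Node b us # ts) = plug (c b) (subst_forest c us) @ subst_forest c ts"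

lemma subst_append: "subst c (p @ q) = subst c p @ subst c q"
  by (induction c p rule: subst.induct) auto

lemma comp_ctxt_mono: "p \<preceq>\<^sub>p q \<Longrightarrow> comp_ctxt c p \<preceq>\<^sub>p comp_ctxt c q"
  by (induction c p rule: comp_ctxt.induct) (auto intro: piece_append piece_keep)

text \<open>Delete all nodes around one hole of \<open>c\<close>. Under substitution this is what
  deletion of a letter becomes.\<close>

lemma piece_comp_ctxt:
  "holes_are_leaves c \<Longrightarrow> count_list (labels c) None > 0 \<Longrightarrow> p \<preceq>\<^sub>p comp_ctxt c p"
proof (induction c p rule: comp_ctxt.induct)
  case (2 us ts q)
  show ?case using piece_append[of q q "[]" "comp_ctxt ts q"] by simp
next
  case (3 a us ts q)
  consider "count_list (labels us) None > 0" | "count_list (labels ts) None > 0"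
    using 3(4) by (auto split: if_splits)
  then show ?case
  proof cases
    case 1
    then have "q \<preceq>\<^sub>p comp_ctxt us q" using 3 by simp
    then show ?thesis using piece_skip[of q "comp_ctxt us q" "[]" "comp_ctxt ts q"] by simp
  next
    case 2
    then have "q \<preceq>\<^sub>p comp_ctxt ts q" using 3 by simp
    then show ?thesis using piece_skip[of "[]" "comp_ctxt us q" q "comp_ctxt ts q"] by simp
  qed
qed simp

lemma subst_mono:
  assumes c: "\<And>b. c b \<in> contexts A"
  shows "p \<preceq>\<^sub>p q \<Longrightarrow> holes_are_leaves q \<Longrightarrow> subst c p \<preceq>\<^sub>p subst c q"
  unfolding piece_emb[of p q]
proof (induction rule: emb.induct)
  case (keep p q p' q' x)
  then have IH: "subst c p \<preceq>\<^sub>p subst c q" "subst c p' \<preceq>\<^sub>p subst c q'" by simp_all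
  show ?case
  proof (cases x)
    case None
    then show ?thesis using piece_keep[of "[]" "[]" "subst c p'" "subst c q'" None] IH by simp
  next
    case (Some b)
    then show ?thesis using piece_append[OF comp_ctxt_mono[OF IH(1)] IH(2)] by simp
  qed
next
  case (skip p q p' q' x)
  then have IH: "subst c p \<preceq>\<^sub>p subst c q" "subst c p' \<preceq>\<^sub>p subst c q'" by simp_all
  show ?case
  proof (cases x)
    case None
    then have "p = []" using skip by (simp add: emb_Nil_right)
    then show ?thesis using None piece_skip[of "[]" "[]" "subst c p'" "subst c q'" None] IH by simp
  next
    case (Some b)
    have "subst c p \<preceq>\<^sub>p comp_ctxt (c b) (subst c q)"
      using piece_trans[OF IH(1) piece_comp_ctxt] c[of b] by (simp add: contexts_def)
    then show ?thesis using Some piece_append[OF _ IH(2)] by (simp add: subst_append)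
  qed
qed simp

lemma embed_append: "embed (s @ t) = embed s @ embed t"
  by (simp add: embed_def)

lemma comp_ctxt_embed_right: "comp_ctxt p (embed s) = embed (plug p s)"
  by (induction p s rule: plug.induct) (auto simp: embed_def)

lemma subst_embed: "subst c (embed s) = embed (subst_forest c s)"
proof (induction s rule: labels.induct)
  case (2 b us ts)
  have "embed (Node b us # ts) = Node (Some b) (embed us) # embed ts"
    by (simp add: embed_def)
  then show ?case using 2 by (simp add: embed_append comp_ctxt_embed_right)
qed (simp add: embed_def)

lemma subst_hole [simp]: "subst c hole = hole"
  by (simp add: hole_def)

lemma subst_forest_in_forests: "(\<And>b. c b \<in> contexts A) \<Longrightarrow> subst_forest c s \<in> forests A"
  by (induction c s rule: subst_forest.induct) auto

text \<open>The morphism is determined by the images of the one-node contexts. Representatives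
  \<open>c b\<close> of these images define a substitution that induces it, first on forests and
  then, by way of words, on contexts.\<close>

lemma ver_pieceD:
  assumes "ver_piece (syntactic_alg A L) v u"
  shows "\<exists>p \<in> contexts A. \<exists>q \<in> contexts A. p \<preceq>\<^sub>p q \<and> v = syn_rel_ctxt A L `` {p} \<and> u = syn_rel_ctxt A L `` {q}"
proof -
  let ?F = "syntactic_alg A L"
  let ?R = "\<lambda>s. syn_rel A L `` {s}" and ?C = "\<lambda>p. syn_rel_ctxt A L `` {p}"
  obtain B :: "nat set" and \<alpha> \<beta> p q where
    mor: "forest_alg_morphism (free_forest_alg B) ?F \<alpha> \<beta>" and
    pq: "p \<in> contexts B" "q \<in> contexts B" "p \<preceq>\<^sub>p q" "\<beta> p = v" "\<beta> q = u"
    using assms by (auto simp: ver_piece_def)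
  have append: "\<alpha> (s @ t) = \<alpha> s \<otimes>\<^bsub>Hor ?F\<^esub> \<alpha> t" if "s \<in> forests B" "t \<in> forests B" for s t
    using mor that by (simp add: forest_alg_morphism_def hom_def)
  have comp: "\<beta> (comp_ctxt s t) = \<beta> s \<otimes>\<^bsub>Ver ?F\<^esub> \<beta> t" if "s \<in> contexts B" "t \<in> contexts B" for s t
    using mor that by (simp add: forest_alg_morphism_def hom_def)
  have act: "\<alpha> (plug s t) = act ?F (\<beta> s) (\<alpha> t)" if "s \<in> contexts B" "t \<in> forests B" for s t
    using mor that by (simp add: forest_alg_morphism_def)
  have add: "\<beta> (embed s @ hole) = add_left ?F (\<alpha> s)" "\<beta> (hole @ embed s) = add_right ?F (\<alpha> s)"
    if "s \<in> forests B" for s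
    using mor that by (simp_all add: forest_alg_morphism_def)
  have one: "\<alpha> [] = ?R []" "\<beta> hole = ?C hole"
    using mor by (simp_all add: forest_alg_morphism_def syntactic_alg_simps)
  let ?node = "\<lambda>b. [Node (Some b) hole]"
  have node: "?node b \<in> contexts B" if "b \<in> B" for b
    using that by (auto simp: contexts_def forests_def hole_def)
  \<comment> \<open>Letters outside \<open>B\<close> are sent to the hole, so that \<open>c\<close>
    yields a context everywhere.\<close>
  have "\<exists>r \<in> contexts A. b \<in> B \<longrightarrow> ?C r = \<beta> (?node b)" for b
  proof (cases "b \<in> B")
    case True
    then have "\<beta> (?node b) \<in> carrier (Ver ?F)"
      using mor node by (auto simp: forest_alg_morphism_def hom_def)
    then show ?thesis by (elim syntactic_algE(2)) auto
  qed (use hole_in_contexts in blast)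
  then obtain c where c: "\<And>b. c b \<in> contexts A" "\<And>b. b \<in> B \<Longrightarrow> ?C (c b) = \<beta> (?node b)"
    by metis
  have forest: "\<alpha> s = ?R (subst_forest c s)" if "s \<in> forests B" for s
    using that
  proof (induction s rule: labels.induct)
    case 1
    then show ?case by (simp add: one)
  next
    case (2 b us ts)
    then have in_B: "b \<in> B" "us \<in> forests B" "ts \<in> forests B" by (auto simp: forests_def)
    have "[Node b us] \<in> forests B" using in_B by (auto simp: forests_def)
    then have "\<alpha> (Node b us # ts) = \<alpha> (plug (?node b) us) \<otimes>\<^bsub>Hor ?F\<^esub> \<alpha> ts"
      using append[of "[Node b us]" ts] in_B by simp
    also have "\<dots> = ?R (subst_forest c (Node b us # ts))"
      using 2(1)[OF in_B(2)] 2(2)[OF in_B(3)] act[OF node[OF in_B(1)] in_B(2)] in_B(1) c(1)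
      by (simp add: c(2)[symmetric] syntactic_alg_simps subst_forest_in_forests[OF c(1)])
    finally show ?case .
  qed
  have word: "subst c (ctx w) \<in> contexts A \<and> \<beta> (ctx w) = ?C (subst c (ctx w))" if "w \<in> words B" for w
    using that
  proof (induction w)
    case Nil
    then show ?case by (simp add: one)
  next
    case (Cons x w)
    obtain f y g where x: "x = (f, y, g)" by (cases x)
    then have fg: "f \<in> forests B" "g \<in> forests B" "w \<in> words B" "\<And>b. y = Some b \<Longrightarrow> b \<in> B"
      using Cons.prems by (auto simp: words_Cons)
    \<comment> \<open>This separates the node of the letter, handled by \<open>c\<close>, from its
      side forests, handled by \<open>add_left\<close> and \<open>add_right\<close>.\<close>
    define r where "r = (case y of None \<Rightarrow> ctx w | Some b \<Rightarrow> [Node (Some b) (ctx w)])"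
    have r: "r \<in> contexts B \<and> subst c r \<in> contexts A \<and> \<beta> r = ?C (subst c r)"
    proof (cases y)
      case None
      then show ?thesis using Cons.IH fg by (simp add: r_def ctx_in_contexts)
    next
      case (Some b)
      have "r = comp_ctxt (?node b) (ctx w)" using Some by (simp add: r_def)
      then have "r \<in> contexts B"
        using node[OF fg(4)[OF Some]] fg(3) by (simp only: comp_ctxt_in_contexts ctx_in_contexts)
      then show ?thesis
        using Cons.IH[OF fg(3)] Some fg node[of b] comp[of "?node b" "ctx w"] c(1)
        by (simp add: r_def ctx_in_contexts c(2)[symmetric] syntactic_alg_simps)
    qed
    have "ctx (x # w) = embed f @ r @ embed g" using x by (cases y) (simp_all add: r_def)
    also have "\<dots> = comp_ctxt (embed f @ hole) (comp_ctxt (hole @ embed g) r)"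
      by (simp add: comp_ctxt_append)
    finally have eq: "ctx (x # w) = \<dots>" .
    have subst_eq: "subst c (ctx (x # w)) =
      comp_ctxt (embed (subst_forest c f) @ hole) (comp_ctxt (hole @ embed (subst_forest c g)) (subst c r))"
      unfolding eq by (simp add: comp_ctxt_append subst_append subst_embed)
    have sub: "subst_forest c f \<in> forests A" "subst_forest c g \<in> forests A"
      by (rule subst_forest_in_forests[OF c(1)])+
    have "\<beta> (ctx (x # w)) = ?C (subst c (ctx (x # w)))"
      unfolding subst_eq unfolding eq using r fg sub
      by (simp add: comp add forest syntactic_alg_simps)
    then show ?case unfolding subst_eq using r sub by simp
  qed
  have ctxt: "subst c r \<in> contexts A \<and> \<beta> r = ?C (subst c r)" if "r \<in> contexts B" for r
    using contexts_ctx[OF that] word by blast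
  moreover have "subst c p \<preceq>\<^sub>p subst c q"
    using subst_mono[OF c(1) pq(3)] pq(2) by (simp add: contexts_def)
  ultimately show ?thesis using pq by blast
qed

section \<open>Piecewise testable languages\<close>

lemma syn_class_plug:
  assumes "s \<in> forests A" "t \<in> forests A" "p \<in> contexts A" "q \<in> contexts A"
    and "syn_rel A L `` {s} = syn_rel A L `` {t}" "syn_rel_ctxt A L `` {p} = syn_rel_ctxt A L `` {q}"
  shows "syn_rel A L `` {plug p s} = syn_rel A L `` {plug q t}"
proof -
  have "(s, t) \<in> syn_rel A L"
    using assms(5) eq_equiv_class_iff[OF equiv_syn_rel assms(1,2)] by blast
  moreover have "(p, q) \<in> syn_rel_ctxt A L"
    using assms(6) eq_equiv_class_iff[OF equiv_syn_rel_ctxt assms(3,4)] by blast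
  ultimately show ?thesis by (intro equiv_class_eq[OF equiv_syn_rel] plug_syn_rel)
qed

lemma word_pow_Suc_right: "word_pow (Suc k) w = word_pow k w @ w"
  by (induction k) simp_all

lemma syn_class_ctx_pow:
  assumes "w \<in> words A"
  shows "(syn_rel_ctxt A L `` {ctx w}) [^]\<^bsub>Ver (syntactic_alg A L)\<^esub> k =
    syn_rel_ctxt A L `` {ctx (word_pow k w)}"
proof (induction k)
  case 0
  then show ?case by (simp add: syntactic_alg_simps)
next
  case (Suc k)
  show ?case
    unfolding word_pow_Suc_right
    using Suc assms by (simp add: syntactic_alg_simps ctx_in_contexts words_pow ctx_append)
qed

text \<open>Allows \<omega> to be replaced by any positive multiple of it, in particular by one that
  exceeds the size of the tested pieces.\<close>

lemma nat_pow_idem_multiple: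
  assumes "monoid V" "v \<in> carrier V"
    and idem: "v [^]\<^bsub>V\<^esub> (n :: nat) \<otimes>\<^bsub>V\<^esub> v [^]\<^bsub>V\<^esub> n = v [^]\<^bsub>V\<^esub> n"
  shows "v [^]\<^bsub>V\<^esub> (Suc k * n) = v [^]\<^bsub>V\<^esub> n"
proof (induction k)
  case (Suc k)
  have "v [^]\<^bsub>V\<^esub> (Suc (Suc k) * n) = v [^]\<^bsub>V\<^esub> n \<otimes>\<^bsub>V\<^esub> v [^]\<^bsub>V\<^esub> (Suc k * n)"
    using monoid.nat_pow_mult[OF assms(1,2), of n "Suc k * n"] by simp
  then show ?case using Suc idem by simp
qed simp

text \<open>For every \<open>s\<close>, both products applied to \<open>s\<close> lie between the
  powers \<open>k\<close> and \<open>Suc k\<close> of \<open>w\<close> applied to \<open>s\<close>.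
  These have the same pieces with at most \<open>n\<close> nodes, also inside any further
  context.\<close>

lemma piecewise_testable_absorbs:
  assumes test: "\<And>s t. s \<in> forests A \<Longrightarrow> t \<in> forests A \<Longrightarrow>
      {r. r \<preceq>\<^sub>p s \<and> num_nodes r \<le> n} = {r. r \<preceq>\<^sub>p t \<and> num_nodes r \<le> n} \<Longrightarrow> s \<in> L \<longleftrightarrow> t \<in> L"
    and p: "p \<in> contexts A" and w: "w \<in> words A" and le: "p \<preceq>\<^sub>p ctx w" and "n \<le> k"
  shows "(comp_ctxt (ctx (word_pow k w)) p, ctx (word_pow k w)) \<in> syn_rel_ctxt A L"
    "(comp_ctxt p (ctx (word_pow k w)), ctx (word_pow k w)) \<in> syn_rel_ctxt A L"
proof -
  have pow: "word_pow (Suc k) w = w @ word_pow k w" "word_pow (Suc k) w = word_pow k w @ w"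
    by (simp, rule word_pow_Suc_right)
  have pow_in: "ctx (word_pow k w) \<in> contexts A" by (intro ctx_in_contexts words_pow w)
  obtain v where v: "v \<in> words A" "p = ctx v" using contexts_ctx[OF p] by blast
  have plug_p: "s \<preceq>\<^sub>p plug p s" "plug p s \<preceq>\<^sub>p app w s" for s
    using piece_app[of s v] plug_mono[OF le, of s] ctx_in_contexts[OF w]
    by (simp_all add: v(2) plug_ctx contexts_def)
  have mem: "app z x \<in> L \<longleftrightarrow> app z y \<in> L"
    if z: "z \<in> words A" and s: "s \<in> forests A" and x: "x \<in> forests A" and y: "y = app (word_pow k w) s"
      and yx: "y \<preceq>\<^sub>p x" and xy: "x \<preceq>\<^sub>p app (word_pow (Suc k) w) s" for z s x y
  proof (rule test)
    show "app z x \<in> forests A" "app z y \<in> forests A"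
      using plug_in_forests[OF ctx_in_contexts[OF z]] plug_in_forests[OF pow_in s] x
      by (simp_all add: y plug_ctx)
    have small: "r \<preceq>\<^sub>p app z y" if "r \<preceq>\<^sub>p app z x" "num_nodes r \<le> n" for r
    proof -
      have "r \<preceq>\<^sub>p app z (app (word_pow (Suc k) w) s)"
        using that(1) app_mono[OF word_le_refl xy] by (rule piece_trans)
      then show ?thesis
        unfolding y by (rule small_piece_app_pow) (use that(2) \<open>n \<le> k\<close> in simp)
    qed
    show "{r. r \<preceq>\<^sub>p app z x \<and> num_nodes r \<le> n} = {r. r \<preceq>\<^sub>p app z y \<and> num_nodes r \<le> n}"
      using small piece_trans[OF _ app_mono[OF word_le_refl yx]] by blast
  qed
  have rel: "(x, y) \<in> syn_rel A L"
    if s: "s \<in> forests A" and x: "x \<in> forests A" and y: "y = app (word_pow k w) s"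
      and yx: "y \<preceq>\<^sub>p x" and xy: "x \<preceq>\<^sub>p app (word_pow (Suc k) w) s" for s x y
  proof -
    have "plug r x \<in> L \<longleftrightarrow> plug r y \<in> L" if "r \<in> contexts A" for r
      using contexts_ctx[OF that] mem[OF _ s x y yx xy] by (auto simp: plug_ctx)
    moreover have "y \<in> forests A" using plug_in_forests[OF pow_in s] by (simp add: y plug_ctx)
    ultimately show ?thesis using x by (simp add: syn_rel_def)
  qed
  have in_forests: "plug p s \<in> forests A" "app (word_pow k w) s \<in> forests A" if "s \<in> forests A" for s
    using that p plug_in_forests[OF pow_in that] by (simp_all add: plug_ctx)
  show "(comp_ctxt (ctx (word_pow k w)) p, ctx (word_pow k w)) \<in> syn_rel_ctxt A L"
    unfolding syn_rel_ctxt_def mem_Collect_eq prod.case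
  proof (intro conjI ballI)
    fix s assume s: "s \<in> forests A"
    have "(app (word_pow k w) (plug p s), app (word_pow k w) s) \<in> syn_rel A L"
    proof (rule rel[OF s in_forests(2)[OF in_forests(1)[OF s]] refl])
      show "app (word_pow k w) s \<preceq>\<^sub>p app (word_pow k w) (plug p s)"
        by (rule app_mono[OF word_le_refl plug_p(1)])
      show "app (word_pow k w) (plug p s) \<preceq>\<^sub>p app (word_pow (Suc k) w) s"
        unfolding pow(2) using app_mono[OF word_le_refl plug_p(2)] by simp
    qed
    then show "(plug (comp_ctxt (ctx (word_pow k w)) p) s, plug (ctx (word_pow k w)) s) \<in> syn_rel A L"
      by (simp add: plug_comp_ctxt plug_ctx)
  qed (use p pow_in in simp_all)
  show "(comp_ctxt p (ctx (word_pow k w)), ctx (word_pow k w)) \<in> syn_rel_ctxt A L"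
    unfolding syn_rel_ctxt_def mem_Collect_eq prod.case
  proof (intro conjI ballI)
    fix s assume s: "s \<in> forests A"
    have "(plug p (app (word_pow k w) s), app (word_pow k w) s) \<in> syn_rel A L"
    proof (rule rel[OF s in_forests(1)[OF in_forests(2)[OF s]] refl plug_p(1)])
      show "plug p (app (word_pow k w) s) \<preceq>\<^sub>p app (word_pow (Suc k) w) s"
        unfolding pow(1) using plug_p(2) by simp
    qed
    then show "(plug (comp_ctxt p (ctx (word_pow k w))) s, plug (ctx (word_pow k w)) s) \<in> syn_rel A L"
      by (simp add: plug_comp_ctxt plug_ctx)
  qed (use p pow_in in simp_all)
qed

theorem theorem4:
  fixes A :: "'a set" and L :: "'a forest set" and \<omega> :: nat
  defines "V \<equiv> Ver (syntactic_alg A L)"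
  assumes "finite A"
    and "L \<subseteq> forests A"
    and "regular A L"
    and "\<omega> > 0"
    and "\<forall>v \<in> carrier V. v [^]\<^bsub>V\<^esub> \<omega> \<otimes>\<^bsub>V\<^esub> v [^]\<^bsub>V\<^esub> \<omega> = v [^]\<^bsub>V\<^esub> \<omega>"
  shows "piecewise_testable A L \<longleftrightarrow>
    (\<forall>u \<in> carrier V. \<forall>v \<in> carrier V. ver_piece (syntactic_alg A L) v u \<longrightarrow>
       u [^]\<^bsub>V\<^esub> \<omega> \<otimes>\<^bsub>V\<^esub> v = u [^]\<^bsub>V\<^esub> \<omega> \<and> v \<otimes>\<^bsub>V\<^esub> u [^]\<^bsub>V\<^esub> \<omega> = u [^]\<^bsub>V\<^esub> \<omega>)"
    (is "_ \<longleftrightarrow> ?identity")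
proof
  let ?C = "\<lambda>p. syn_rel_ctxt A L `` {p}" and ?R = "\<lambda>s. syn_rel A L `` {s}"
  have monoid: "monoid V"
    unfolding V_def by (rule forest_algebra.Ver_monoid[OF forest_algebra_syntactic])
  {
    assume "piecewise_testable A L"
    then obtain n where test: "\<And>s t. s \<in> forests A \<Longrightarrow> t \<in> forests A \<Longrightarrow>
      {r. r \<preceq>\<^sub>p s \<and> num_nodes r \<le> n} = {r. r \<preceq>\<^sub>p t \<and> num_nodes r \<le> n} \<Longrightarrow> s \<in> L \<longleftrightarrow> t \<in> L"
      unfolding piecewise_testable_def by blast
    show ?identity
    proof (intro ballI impI)
      fix u v assume u: "u \<in> carrier V" and "v \<in> carrier V" and "ver_piece (syntactic_alg A L) v u"
      from ver_pieceD[OF this(3)] obtain p q where p: "p \<in> contexts A" "v = ?C p"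
        and q: "q \<in> contexts A" "u = ?C q" and le: "p \<preceq>\<^sub>p q" by blast
      obtain w where w: "w \<in> words A" "q = ctx w" using contexts_ctx[OF q(1)] by blast
      \<comment> \<open>A multiple of \<omega> that is at least \<open>n\<close>; the factor
        \<open>Suc n\<close> keeps it positive, so the power is still the idempotent one.\<close>
      let ?k = "Suc n * \<omega>"
      let ?e = "ctx (word_pow ?k w)"
      have e: "?e \<in> contexts A" by (intro ctx_in_contexts words_pow w)
      have "u [^]\<^bsub>V\<^esub> \<omega> = u [^]\<^bsub>V\<^esub> ?k"
        by (rule nat_pow_idem_multiple[symmetric, OF monoid u]) (use assms(6) u in blast)
      also have "\<dots> = ?C ?e" unfolding V_def q(2) w(2) by (rule syn_class_ctx_pow[OF w(1)])
      finally have pow: "u [^]\<^bsub>V\<^esub> \<omega> = ?C ?e" .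
      have "n * 1 \<le> Suc n * \<omega>" using assms(5) by (intro mult_le_mono) auto
      then have "n \<le> ?k" by simp
      note absorb = piecewise_testable_absorbs[OF test p(1) w(1) le[unfolded w(2)] this]
      have "u [^]\<^bsub>V\<^esub> \<omega> \<otimes>\<^bsub>V\<^esub> v = ?C (comp_ctxt ?e p)" "v \<otimes>\<^bsub>V\<^esub> u [^]\<^bsub>V\<^esub> \<omega> = ?C (comp_ctxt p ?e)"
        unfolding pow p(2) unfolding V_def
        by (rule syntactic_alg_simps(3)[OF e p(1)] syntactic_alg_simps(3)[OF p(1) e])+
      then show "u [^]\<^bsub>V\<^esub> \<omega> \<otimes>\<^bsub>V\<^esub> v = u [^]\<^bsub>V\<^esub> \<omega> \<and> v \<otimes>\<^bsub>V\<^esub> u [^]\<^bsub>V\<^esub> \<omega> = u [^]\<^bsub>V\<^esub> \<omega>"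
        using equiv_class_eq[OF equiv_syn_rel_ctxt absorb(1)]
          equiv_class_eq[OF equiv_syn_rel_ctxt absorb(2)] unfolding pow by (simp only: simp_thms)
    qed
  next
    assume identity: ?identity
    \<comment> \<open>\<open>ver_pieceI\<close> turns the order on words over \<open>A\<close> into
      \<open>ver_piece\<close>, which makes the identity applicable.\<close>
    have absorb: "?C (ctx (word_pow \<omega> w @ v)) = ?C (ctx (word_pow \<omega> w))"
      "?C (ctx (v @ word_pow \<omega> w)) = ?C (ctx (word_pow \<omega> w))"
      if vw: "v \<in> words A" "w \<in> words A" "word_le v w" for v w
    proof -
      note ctxts = ctx_in_contexts[OF vw(1)] ctx_in_contexts[OF vw(2)]
        ctx_in_contexts[OF words_pow[OF vw(2)]]
      have "ver_piece (syntactic_alg A L) (?C (ctx v)) (?C (ctx w))"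
        by (rule ver_pieceI[OF assms(2) ctxts(1,2) ctx_mono[OF vw(3)]])
      moreover have "?C (ctx v) \<in> carrier V" "?C (ctx w) \<in> carrier V"
        unfolding V_def using ctxts by (auto intro: syntactic_alg_closed)
      ultimately have "?C (ctx w) [^]\<^bsub>V\<^esub> \<omega> \<otimes>\<^bsub>V\<^esub> ?C (ctx v) = ?C (ctx w) [^]\<^bsub>V\<^esub> \<omega>"
        "?C (ctx v) \<otimes>\<^bsub>V\<^esub> ?C (ctx w) [^]\<^bsub>V\<^esub> \<omega> = ?C (ctx w) [^]\<^bsub>V\<^esub> \<omega>"
        using identity by blast+
      then show "?C (ctx (word_pow \<omega> w @ v)) = ?C (ctx (word_pow \<omega> w))"
        "?C (ctx (v @ word_pow \<omega> w)) = ?C (ctx (word_pow \<omega> w))"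
        unfolding V_def syn_class_ctx_pow[OF vw(2)] using ctxts
        by (simp_all add: syntactic_alg_simps ctx_append)
    qed
    have app_class: "?R (app v s) = ?R (app w t)"
      if "v \<in> words A" "w \<in> words A" "?C (ctx v) = ?C (ctx w)" "s \<in> forests A" "t \<in> forests A"
        "?R s = ?R t" for v w s t
      using syn_class_plug[OF that(4,5) ctx_in_contexts[OF that(1)] ctx_in_contexts[OF that(2)] that(6,3)]
      by (simp add: plug_ctx)
    let ?r = "restrict_labels A" and ?rw = "map (restrict_letter A)"
    \<comment> \<open>Restriction of labels commutes with \<open>app\<close> and preserves the order
      on words, so the laws for words over \<open>A\<close> extend to all words.\<close>
    interpret absorbing_colouring "\<lambda>s. ?R (?r s)" \<omega>
    proof
      show "finite (range (\<lambda>s. ?R (?r s)))"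
        by (rule finite_subset[of _ "carrier (Hor (syntactic_alg A L))"])
          (use assms(4) in \<open>auto simp: regular_def syntactic_alg_closed\<close>)
    next
      fix s t w assume "?R (?r s) = ?R (?r t)"
      then show "?R (?r (app w s)) = ?R (?r (app w t))"
        unfolding restrict_labels_app
        by (intro app_class restrict_letter_words restrict_labels_in_forests) auto
    next
      fix v w s assume le: "word_le v (w :: 'a letter list)"
      note rw = restrict_letter_words[of A v] restrict_letter_words[of A w] restrict_letter_mono[OF le, of A]
      have "?R (app (word_pow \<omega> (?rw w) @ ?rw v) (?r s)) = ?R (app (word_pow \<omega> (?rw w)) (?r s))"
        using rw by (intro app_class absorb) (auto simp: words_append words_pow)
      then show "?R (?r (app (word_pow \<omega> w) (app v s))) = ?R (?r (app (word_pow \<omega> w) s))"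
        by (simp only: restrict_labels_app map_word_pow foldr_append comp_apply)
      have "?R (app (?rw v @ word_pow \<omega> (?rw w)) (?r s)) = ?R (app (word_pow \<omega> (?rw w)) (?r s))"
        using rw by (intro app_class absorb) (auto simp: words_append words_pow)
      then show "?R (?r (app v (app (word_pow \<omega> w) s))) = ?R (?r (app (word_pow \<omega> w) s))"
        by (simp only: restrict_labels_app map_word_pow foldr_append comp_apply)
    qed
    obtain n where n: "\<And>s t. {r. r \<preceq>\<^sub>p s \<and> num_nodes r \<le> n} = {r. r \<preceq>\<^sub>p t \<and> num_nodes r \<le> n} \<Longrightarrow>
      ?R (?r s) = ?R (?r t)"
      using colour_determined_by_pieces by blast
    have "s \<in> L \<longleftrightarrow> t \<in> L" if st: "s \<in> forests A" "t \<in> forests A"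
      and eq: "{r. r \<preceq>\<^sub>p s \<and> num_nodes r \<le> n} = {r. r \<preceq>\<^sub>p t \<and> num_nodes r \<le> n}" for s t
    proof -
      have "?R s = ?R t" using n[OF eq] st by (simp add: restrict_labels_id)
      then have "(s, t) \<in> syn_rel A L" using eq_equiv_class_iff[OF equiv_syn_rel st] by blast
      then have "\<forall>p \<in> contexts A. plug p s \<in> L \<longleftrightarrow> plug p t \<in> L" by (simp add: syn_rel_def)
      \<comment> \<open>Equivalent forests agree on membership in \<open>L\<close>, as the empty
        context shows.\<close>
      then have "plug hole s \<in> L \<longleftrightarrow> plug hole t \<in> L" using hole_in_contexts by blast
      then show ?thesis by simp
    qed
    then show "piecewise_testable A L" unfolding piecewise_testable_def by blast
  }
qed

end
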